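(* Let $(N_1,g_1)$ and $(N_2,g_2)$ be compact and connected Riemannian manifolds without boundary. For $j=1,2$ let $M_j\subset N_j$ be an open set and let $F_j=N_j\setminus M_j$. Assume that $F_j^{int}\neq\emptyset$ and that $F_j$ is a smooth manifold with smooth boundary $\partial F_j=\partial M_j$. Suppose that there is a diffeomorphism $\phi:F_1\to F_2$ such that $\phi^\ast g_2|_{F_2}=g_1|_{F_1}$ and $$\{D^1_x(\cdot,\cdot)\ ;\ x\in M_1\}=\{D^2_y(\phi(\cdot),\phi(\cdot))\ ;\ y\in M_2\}.$$ Then: (i) The map $\phi:F_1\to F_2$ is a metric isometry with respect to the ambient distances, that is, $d_1(z,w)=d_2(\phi(z),\phi(w))$ for all $z,w\in F_1$. (ii) $\{D^1_x(\cdot,\cdot)\ ;\ x\in N_1\}=\{D^2_y(\phi(\cdot),\phi(\cdot))\ ;\ y\in N_2\}.$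
   Context: For $j=1,2$, $d_j$ denotes the Riemannian distance function of the whole manifold $(N_j,g_j)$, and $F_j^{int}$ is the interior of $F_j$. For $x\in N_j$ the distance difference function is $D^j_x:F_j\times F_j\to\mathbb{R}$, $D^j_x(z_1,z_2)=d_j(z_1,x)-d_j(z_2,x)$. The collections above are unindexed subsets of $C(F_1\times F_1)$. *)

theory Defs
  imports "HOL-Analysis.Analysis"
begin

section \<open>Smooth maps between Euclidean spaces\<close>

text \<open>
  Both notions are meant for open sets \<open>S\<close>.  \<open>Ck_on n f S\<close> says that all iterated directional
  derivatives of order at most \<open>n\<close> exist and are continuous, each derivative being taken
  in the Frechet sense.
\<close>

primrec Ck_on :: "nat \<Rightarrow> ('e::euclidean_space \<Rightarrow> 'f::real_normed_vector) \<Rightarrow> 'e set \<Rightarrow> bool" where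
  "Ck_on 0 f S \<longleftrightarrow> continuous_on S f"
| "Ck_on (Suc n) f S \<longleftrightarrow>
     (\<forall>x\<in>S. f differentiable (at x)) \<and> (\<forall>v. Ck_on n (\<lambda>x. frechet_derivative f (at x) v) S)"

definition smooth_on :: "'e set \<Rightarrow> ('e::euclidean_space \<Rightarrow> 'f::real_normed_vector) \<Rightarrow> bool" where
  "smooth_on S f \<longleftrightarrow> (\<forall>n. Ck_on n f S)"

section \<open>Smooth manifolds without boundary\<close>

text \<open>
  A manifold is a whole type \<open>'a\<close> with its topology, modelled on the Euclidean space \<open>'e\<close>.
  A chart is a pair of its domain and its coordinate map; only the values of the
  map on the domain matter.
\<close>

type_synonym ('a, 'e) chart = "'a set \<times> ('a \<Rightarrow> 'e)"

definition chart_inv :: "('a, 'e) chart \<Rightarrow> 'e \<Rightarrow> 'a" where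
  "chart_inv \<kappa> = inv_into (fst \<kappa>) (snd \<kappa>)"

definition is_chart :: "('a::topological_space, 'e::euclidean_space) chart \<Rightarrow> bool" where
  "is_chart \<kappa> \<longleftrightarrow> open (fst \<kappa>) \<and> open (snd \<kappa> ` fst \<kappa>) \<and>
     homeomorphism (fst \<kappa>) (snd \<kappa> ` fst \<kappa>) (snd \<kappa>) (chart_inv \<kappa>)"

definition compatible ::
  "('a::topological_space, 'e::euclidean_space) chart \<Rightarrow> ('a, 'e) chart \<Rightarrow> bool" where
  "compatible \<kappa> \<kappa>' \<longleftrightarrow>
     smooth_on (snd \<kappa> ` (fst \<kappa> \<inter> fst \<kappa>')) (snd \<kappa>' \<circ> chart_inv \<kappa>) \<and>
     smooth_on (snd \<kappa>' ` (fst \<kappa> \<inter> fst \<kappa>')) (snd \<kappa> \<circ> chart_inv \<kappa>')"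

definition smooth_atlas :: "('a::topological_space, 'e::euclidean_space) chart set \<Rightarrow> bool" where
  "smooth_atlas A \<longleftrightarrow> (\<forall>\<kappa>\<in>A. is_chart \<kappa>) \<and> (\<Union>\<kappa>\<in>A. fst \<kappa>) = UNIV \<and>
     (\<forall>\<kappa>\<in>A. \<forall>\<kappa>'\<in>A. compatible \<kappa> \<kappa>')"

definition maximal_atlas ::
  "('a::topological_space, 'e::euclidean_space) chart set \<Rightarrow> ('a, 'e) chart set" where
  "maximal_atlas A = {\<kappa>. is_chart \<kappa> \<and> (\<forall>\<kappa>'\<in>A. compatible \<kappa> \<kappa>')}"

section \<open>Codimension zero submanifolds with boundary\<close>

text \<open>
  \<open>half_space_chart A F b \<kappa>\<close>: in the smooth chart \<open>\<kappa>\<close> the set \<open>F\<close> is the part of the chart where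
  the coordinate in direction \<open>b\<close> is nonnegative.  Charts that do not meet the wall of the half
  space serve as interior charts of \<open>F\<close>.
\<close>

definition half_space_chart ::
  "('a::topological_space, 'e::euclidean_space) chart set \<Rightarrow> 'a set \<Rightarrow> 'e \<Rightarrow> ('a, 'e) chart \<Rightarrow> bool" where
  "half_space_chart A F b \<kappa> \<longleftrightarrow> \<kappa> \<in> maximal_atlas A \<and> b \<in> Basis \<and>
     (\<forall>q\<in>fst \<kappa>. q \<in> F \<longleftrightarrow> 0 \<le> snd \<kappa> q \<bullet> b)"

definition smooth_submanifold_with_boundary ::
  "('a::topological_space, 'e::euclidean_space) chart set \<Rightarrow> 'a set \<Rightarrow> bool" where
  "smooth_submanifold_with_boundary A F \<longleftrightarrow>
     (\<forall>p\<in>F. \<exists>\<kappa> b. half_space_chart A F b \<kappa> \<and> p \<in> fst \<kappa>)"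

definition manifold_boundary ::
  "('a::topological_space, 'e::euclidean_space) chart set \<Rightarrow> 'a set \<Rightarrow> 'a set" where
  "manifold_boundary A F =
     {p \<in> F. \<exists>\<kappa> b. half_space_chart A F b \<kappa> \<and> p \<in> fst \<kappa> \<and> snd \<kappa> p \<bullet> b = 0}"

section \<open>Smooth maps and differentials\<close>

text \<open>
  Smoothness on an arbitrary subset \<open>S\<close>: near each point the coordinate expression is the
  restriction of a smooth map defined on an open set of the model space.  For a submanifold with
  boundary this is the usual notion of smoothness up to the boundary.
\<close>

definition smooth_map_on ::
  "('a::topological_space, 'e::euclidean_space) chart set \<Rightarrow>
   ('b::topological_space, 'f::euclidean_space) chart set \<Rightarrow> 'a set \<Rightarrow> ('a \<Rightarrow> 'b) \<Rightarrow> bool" where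
  "smooth_map_on A B S \<phi> \<longleftrightarrow>
     (\<forall>p\<in>S. \<exists>\<kappa>\<in>A. \<exists>\<kappa>'\<in>B. p \<in> fst \<kappa> \<and> \<phi> p \<in> fst \<kappa>' \<and>
        (\<exists>W h. open W \<and> snd \<kappa> p \<in> W \<and> smooth_on W h \<and>
           (\<forall>q\<in>S \<inter> fst \<kappa>. snd \<kappa> q \<in> W \<longrightarrow> \<phi> q \<in> fst \<kappa>' \<and> snd \<kappa>' (\<phi> q) = h (snd \<kappa> q))))"

definition diffeomorphism_on ::
  "('a::topological_space, 'e::euclidean_space) chart set \<Rightarrow>
   ('b::topological_space, 'f::euclidean_space) chart set \<Rightarrow> 'a set \<Rightarrow> 'b set \<Rightarrow> ('a \<Rightarrow> 'b) \<Rightarrow> bool" where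
  "diffeomorphism_on A B S T \<phi> \<longleftrightarrow> bij_betw \<phi> S T \<and>
     smooth_map_on A B S \<phi> \<and> smooth_map_on B A T (inv_into S \<phi>)"

text \<open>
  The differential at \<open>p\<close> of a map \<open>\<phi>\<close> given on \<open>S\<close>, in the coordinates \<open>\<kappa>\<close> around \<open>p\<close> and
  \<open>\<kappa>'\<close> around \<open>\<phi> p\<close>.  The derivative is taken within the coordinate image of \<open>S\<close>; it is uniquely
  determined also at the boundary points of a submanifold with boundary.
\<close>

definition differential ::
  "('a, 'e::euclidean_space) chart \<Rightarrow> ('b, 'f::euclidean_space) chart \<Rightarrow> 'a set \<Rightarrow> ('a \<Rightarrow> 'b) \<Rightarrow>
   'a \<Rightarrow> 'e \<Rightarrow> 'f" where
  "differential \<kappa> \<kappa>' S \<phi> p =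
     frechet_derivative (snd \<kappa>' \<circ> \<phi> \<circ> chart_inv \<kappa>) (at (snd \<kappa> p) within snd \<kappa> ` (fst \<kappa> \<inter> S))"

section \<open>Riemannian metrics\<close>

text \<open>
  A metric tensor is given by its components: \<open>g \<kappa> p u v\<close> is the inner product of the two tangent
  vectors at \<open>p\<close> that have the coordinates \<open>u\<close> and \<open>v\<close> in the chart \<open>\<kappa>\<close>.  The last
  condition is the transformation law of tangent vectors under a change of charts.
\<close>

type_synonym ('a, 'e) metric_tensor = "('a, 'e) chart \<Rightarrow> 'a \<Rightarrow> 'e \<Rightarrow> 'e \<Rightarrow> real"

definition riemannian_metric ::
  "('a::topological_space, 'e::euclidean_space) chart set \<Rightarrow> ('a, 'e) metric_tensor \<Rightarrow> bool" where
  "riemannian_metric A g \<longleftrightarrow>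
     (\<forall>\<kappa>\<in>A. \<forall>p\<in>fst \<kappa>. bilinear (g \<kappa> p) \<and> (\<forall>u v. g \<kappa> p u v = g \<kappa> p v u) \<and>
        (\<forall>u. u \<noteq> 0 \<longrightarrow> 0 < g \<kappa> p u u)) \<and>
     (\<forall>\<kappa>\<in>A. \<forall>u v. smooth_on (snd \<kappa> ` fst \<kappa>) (\<lambda>x. g \<kappa> (chart_inv \<kappa> x) u v)) \<and>
     (\<forall>\<kappa>\<in>A. \<forall>\<kappa>'\<in>A. \<forall>p\<in>fst \<kappa> \<inter> fst \<kappa>'. \<forall>u v.
        g \<kappa> p u v = g \<kappa>' p (differential \<kappa> \<kappa>' UNIV id p u) (differential \<kappa> \<kappa>' UNIV id p v))"

definition riemannian_manifold ::
  "('a::topological_space, 'e::euclidean_space) chart set \<Rightarrow> ('a, 'e) metric_tensor \<Rightarrow> bool" where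
  "riemannian_manifold A g \<longleftrightarrow> smooth_atlas A \<and> riemannian_metric A g"

text \<open>\<open>pullback_metric_eq A g B h S \<phi>\<close>: on \<open>S\<close> the pullback of the metric \<open>h\<close> under \<open>\<phi>\<close> is \<open>g\<close>.\<close>

definition pullback_metric_eq ::
  "('a::topological_space, 'e::euclidean_space) chart set \<Rightarrow> ('a, 'e) metric_tensor \<Rightarrow>
   ('b::topological_space, 'f::euclidean_space) chart set \<Rightarrow> ('b, 'f) metric_tensor \<Rightarrow>
   'a set \<Rightarrow> ('a \<Rightarrow> 'b) \<Rightarrow> bool" where
  "pullback_metric_eq A g B h S \<phi> \<longleftrightarrow>
     (\<forall>p\<in>S. \<forall>\<kappa>\<in>A. \<forall>\<kappa>'\<in>B. p \<in> fst \<kappa> \<longrightarrow> \<phi> p \<in> fst \<kappa>' \<longrightarrow>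
        (\<forall>u v. h \<kappa>' (\<phi> p) (differential \<kappa> \<kappa>' S \<phi> p u) (differential \<kappa> \<kappa>' S \<phi> p v) = g \<kappa> p u v))"

section \<open>Riemannian distance\<close>

text \<open>Derivatives at the endpoints are one-sided; \<open>a < b\<close> is intended.\<close>

definition C1_curve_on ::
  "('a::topological_space, 'e::euclidean_space) chart set \<Rightarrow> real \<Rightarrow> real \<Rightarrow> (real \<Rightarrow> 'a) \<Rightarrow> bool" where
  "C1_curve_on A a b \<gamma> \<longleftrightarrow> continuous_on {a..b} \<gamma> \<and>
     (\<forall>\<kappa>\<in>A. \<exists>D. continuous_on ({a..b} \<inter> \<gamma> -` fst \<kappa>) D \<and>
        (\<forall>t\<in>{a..b} \<inter> \<gamma> -` fst \<kappa>. ((snd \<kappa> \<circ> \<gamma>) has_vector_derivative D t) (at t within {a..b})))"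

text \<open>
  Piecewise C1: finitely many break points cut \<open>[0,1]\<close> into closed intervals on each of which the
  curve is C1 up to the endpoints.
\<close>

definition piecewise_C1_curve ::
  "('a::topological_space, 'e::euclidean_space) chart set \<Rightarrow> (real \<Rightarrow> 'a) \<Rightarrow> bool" where
  "piecewise_C1_curve A \<gamma> \<longleftrightarrow> path \<gamma> \<and>
     (\<exists>S. finite S \<and>
        (\<forall>a b. 0 \<le> a \<and> a < b \<and> b \<le> 1 \<and> {a<..<b} \<inter> S = {} \<longrightarrow> C1_curve_on A a b \<gamma>))"

text \<open>
  By the transformation law the speed does not depend on the chart chosen around \<open>\<gamma> t\<close>.
  The finitely many break points do not affect the length.
\<close>

definition speed ::
  "('a::topological_space, 'e::euclidean_space) chart set \<Rightarrow> ('a, 'e) metric_tensor \<Rightarrow>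
   (real \<Rightarrow> 'a) \<Rightarrow> real \<Rightarrow> real" where
  "speed A g \<gamma> t =
     (let \<kappa> = (SOME \<kappa>. \<kappa> \<in> A \<and> \<gamma> t \<in> fst \<kappa>); v = vector_derivative (snd \<kappa> \<circ> \<gamma>) (at t)
      in sqrt (g \<kappa> (\<gamma> t) v v))"

definition curve_length ::
  "('a::topological_space, 'e::euclidean_space) chart set \<Rightarrow> ('a, 'e) metric_tensor \<Rightarrow>
   (real \<Rightarrow> 'a) \<Rightarrow> real" where
  "curve_length A g \<gamma> = integral {0..1} (speed A g \<gamma>)"

text \<open>On a connected manifold the infimum is over a nonempty set.\<close>

definition riemannian_dist ::
  "('a::topological_space, 'e::euclidean_space) chart set \<Rightarrow> ('a, 'e) metric_tensor \<Rightarrow>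
   'a \<Rightarrow> 'a \<Rightarrow> real" where
  "riemannian_dist A g x y =
     Inf (curve_length A g ` {\<gamma>. piecewise_C1_curve A \<gamma> \<and> pathstart \<gamma> = x \<and> pathfinish \<gamma> = y})"

text \<open>As a function with domain \<open>F \<times> F\<close> it is \<open>undefined\<close> outside of this set.\<close>

definition dist_diff ::
  "('a::topological_space, 'e::euclidean_space) chart set \<Rightarrow> ('a, 'e) metric_tensor \<Rightarrow>
   'a set \<Rightarrow> 'a \<Rightarrow> 'a \<times> 'a \<Rightarrow> real" where
  "dist_diff A g F x =
     (\<lambda>(z1, z2)\<in>F \<times> F. riemannian_dist A g z1 x - riemannian_dist A g z2 x)"

end

theory Submission
  imports Defs
begin

text \<open>
  If \<open>x \<in> M\<^sub>1\<close> tends to \<open>w \<in> \<partial>M\<^sub>1\<close>, then \<open>d\<^sub>1(z, x) - d\<^sub>1(w, x)\<close> tends to \<open>d\<^sub>1(z, w)\<close>, while the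
  corresponding differences on \<open>N\<^sub>2\<close> are bounded by \<open>d\<^sub>2(\<phi>(z), \<phi>(w))\<close>.  By invariance of domain \<open>\<phi>\<close> maps
  the boundary to the boundary, so exchanging the roles of the two manifolds gives
  \<open>d\<^sub>1(z, w) = d\<^sub>2(\<phi>(z), \<phi>(w))\<close> whenever one of the points is in the boundary.  A curve between
  arbitrary points of \<open>F\<^sub>1\<close> either meets the boundary, and then the triangle inequality
  reduces the claim to this case, or it stays in the interior of \<open>F\<^sub>1\<close>, where \<open>\<phi>\<close> preserves
  its length.
\<close>

section \<open>Continuously differentiable maps\<close>

text \<open>Curves are transported only inside the interior of \<open>F1\<close> or
  \<open>F2\<close>, where the differential relative to that set is the full derivative and the
  chain rule applies. A curve touching the boundary is never transported: it is cut at one boundary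
  point, and a single cut suffices because the boundary case leaves the other point arbitrary. No
  minimising curve is needed, since distances are compared with the lengths of all curves. The model
  spaces have different types, so invariance of domain must be preceded by equality of dimensions;
  this comes from invariance of dimension on the nonempty interiors. \<open>C1_curve_on\<close> has
  one-sided derivatives at endpoints while \<open>speed\<close> takes two-sided ones, so the
  integral arguments keep discarding finite sets of times. Part (ii) follows from (i): for x in
  \<open>F1\<close> the difference functions of x and \<phi>(x) agree, and \<open>M1\<close> and
  \<open>F1\<close> together fill the manifold.\<close>

lemma continuous_on_locally:
  assumes "\<And>x. x \<in> S \<Longrightarrow> \<exists>T. open T \<and> x \<in> T \<and> continuous_on (S \<inter> T) f"
  shows "continuous_on S f"
  unfolding continuous_on_def
proof
  fix x assume x: "x \<in> S"
  obtain T where T: "open T" "x \<in> T" "continuous_on (S \<inter> T) f"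
    using assms[OF x] by blast
  have "at x within S = at x within S \<inter> T"
    using T x by (intro at_within_nhd[of x T]) auto
  then show "(f \<longlongrightarrow> f x) (at x within S)"
    using T x by (simp add: continuous_on_def)
qed

text \<open>This is \<open>Ck_on (Suc 0)\<close> written out. Speeds involve first derivatives only,
  and at this order closure under composition follows from one application of the chain
  rule.\<close>

definition C1_map :: "'e set \<Rightarrow> ('e::euclidean_space \<Rightarrow> 'f::real_normed_vector) \<Rightarrow> bool" where
  "C1_map S f \<longleftrightarrow> (\<forall>x\<in>S. f differentiable (at x)) \<and>
     (\<forall>v. continuous_on S (\<lambda>x. frechet_derivative f (at x) v))"

lemma C1_map_has_derivative:
  "C1_map S f \<Longrightarrow> x \<in> S \<Longrightarrow> (f has_derivative frechet_derivative f (at x)) (at x)"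
  by (simp add: C1_map_def frechet_derivative_works)

lemma C1_map_continuous_on: "C1_map S f \<Longrightarrow> continuous_on S f"
  by (meson C1_map_def continuous_at_imp_continuous_on differentiable_imp_continuous_within)

lemma smooth_on_imp_C1_map: "smooth_on S f \<Longrightarrow> C1_map S f"
  unfolding smooth_on_def C1_map_def by (drule spec[of _ "Suc 0"]) simp

lemma C1_map_subset: "C1_map S f \<Longrightarrow> T \<subseteq> S \<Longrightarrow> C1_map T f"
  by (auto simp: C1_map_def intro: continuous_on_subset)

lemma C1_map_locally:
  assumes "\<And>x. x \<in> S \<Longrightarrow> \<exists>T. open T \<and> x \<in> T \<and> C1_map (S \<inter> T) f"
  shows "C1_map S f"
proof -
  have "f differentiable (at x)" if "x \<in> S" for x
    using assms[OF that] that by (auto simp: C1_map_def)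
  moreover have "continuous_on S (\<lambda>x. frechet_derivative f (at x) v)" for v
    by (rule continuous_on_locally) (use assms in \<open>unfold C1_map_def, blast\<close>)
  ultimately show ?thesis by (simp add: C1_map_def)
qed

lemma C1_map_cong:
  assumes "C1_map S f" "open S" "\<And>x. x \<in> S \<Longrightarrow> f x = g x"
  shows "C1_map S g"
proof -
  have d: "(g has_derivative frechet_derivative f (at x)) (at x)" if "x \<in> S" for x
    using has_derivative_transform_within_open[OF C1_map_has_derivative[OF assms(1) that] assms(2) that assms(3)] .
  then have e: "frechet_derivative f (at x) = frechet_derivative g (at x)" if "x \<in> S" for x
    using that frechet_derivative_at by blast
  have "continuous_on S (\<lambda>x. frechet_derivative g (at x) v)" for v
    using assms(1) e by (simp add: C1_map_def cong: continuous_on_cong)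
  with d show ?thesis by (auto simp: C1_map_def differentiable_def)
qed

text \<open>\<open>C1_map\<close> gives continuity in the base point for each fixed direction. In
  finite dimension this extends to a moving direction: expand it in the basis and use linearity of
  the derivative.\<close>

lemma continuous_on_frechet_derivative:
  fixes f :: "'e::euclidean_space \<Rightarrow> 'f::real_normed_vector"
  assumes f: "C1_map S f" and x: "continuous_on T x" "x ` T \<subseteq> S" and v: "continuous_on T v"
  shows "continuous_on T (\<lambda>t. frechet_derivative f (at (x t)) (v t))"
proof -
  have "frechet_derivative f (at (x t)) (v t) =
      (\<Sum>b\<in>Basis. (v t \<bullet> b) *\<^sub>R frechet_derivative f (at (x t)) b)" if "t \<in> T" for t
  proof -
    have "linear (frechet_derivative f (at (x t)))"
      using that x(2) C1_map_has_derivative[OF f] has_derivative_linear by blast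
    then show ?thesis
      by (subst euclidean_representation[symmetric, of "v t"])
        (simp only: linear_sum linear_scale)
  qed
  moreover have "continuous_on T (\<lambda>t. frechet_derivative f (at (x t)) b)" for b
    using continuous_on_compose2[of S "\<lambda>y. frechet_derivative f (at y) b" T x] f x
    by (simp add: C1_map_def)
  then have "continuous_on T (\<lambda>t. \<Sum>b\<in>Basis. (v t \<bullet> b) *\<^sub>R frechet_derivative f (at (x t)) b)"
    by (intro continuous_intros v)
  ultimately show ?thesis by (simp cong: continuous_on_cong)
qed

text \<open>By the chain rule the derivative of the composite is that of \<open>g\<close> at a
  moving point in a moving direction, which is the situation of
  \<open>continuous_on_frechet_derivative\<close>.\<close>

lemma C1_map_compose:
  assumes f: "C1_map S f" and g: "C1_map T g" and "f ` S \<subseteq> T"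
  shows "C1_map S (g \<circ> f)"
proof -
  have d: "f differentiable (at x)" "g differentiable (at (f x))" if "x \<in> S" for x
    using that assms by (auto simp: C1_map_def)
  have "continuous_on S (\<lambda>x. frechet_derivative (g \<circ> f) (at x) v)" for v
  proof -
    have "continuous_on S (\<lambda>x. frechet_derivative g (at (f x)) (frechet_derivative f (at x) v))"
      using f assms(3)
      by (intro continuous_on_frechet_derivative[OF g] C1_map_continuous_on[OF f]) (simp_all add: C1_map_def)
    then show ?thesis
      using d by (simp add: frechet_derivative_compose cong: continuous_on_cong)
  qed
  with d show ?thesis by (simp add: C1_map_def differentiable_chain_at)
qed

lemma Ck_on_const: "Ck_on n (\<lambda>x. c) S"
  by (induction n arbitrary: c) auto

lemma smooth_on_id: "smooth_on S id"
proof -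
  have "Ck_on n id S" for n
    by (cases n) (auto simp: Ck_on_const id_def)
  then show ?thesis by (simp add: smooth_on_def)
qed

section \<open>Charts and coordinate expressions\<close>

lemma chart_inv_left: "is_chart \<kappa> \<Longrightarrow> q \<in> fst \<kappa> \<Longrightarrow> chart_inv \<kappa> (snd \<kappa> q) = q"
  by (auto simp: is_chart_def homeomorphism_def)

lemma chart_inv_right: "is_chart \<kappa> \<Longrightarrow> x \<in> snd \<kappa> ` fst \<kappa> \<Longrightarrow> snd \<kappa> (chart_inv \<kappa> x) = x"
  by (auto simp: chart_inv_left)

lemma chart_inv_in: "is_chart \<kappa> \<Longrightarrow> x \<in> snd \<kappa> ` fst \<kappa> \<Longrightarrow> chart_inv \<kappa> x \<in> fst \<kappa>"
  by (auto simp: chart_inv_left)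

lemma chart_continuous_on: "is_chart \<kappa> \<Longrightarrow> continuous_on (fst \<kappa>) (snd \<kappa>)"
  by (auto simp: is_chart_def homeomorphism_def)

lemma chart_inv_continuous_on: "is_chart \<kappa> \<Longrightarrow> continuous_on (snd \<kappa> ` fst \<kappa>) (chart_inv \<kappa>)"
  by (auto simp: is_chart_def homeomorphism_def)

lemma open_chart_domain: "is_chart \<kappa> \<Longrightarrow> open (fst \<kappa>)"
  and open_chart_image: "is_chart \<kappa> \<Longrightarrow> open (snd \<kappa> ` fst \<kappa>)"
  by (auto simp: is_chart_def)

lemma open_image_chart:
  assumes \<kappa>: "is_chart \<kappa>" and U: "open U" "U \<subseteq> fst \<kappa>"
  shows "open (snd \<kappa> ` U)"
proof -
  have "snd \<kappa> ` U = chart_inv \<kappa> -` U \<inter> snd \<kappa> ` fst \<kappa>"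
    using U chart_inv_left[OF \<kappa>] by (force simp: image_iff)
  then show ?thesis
    using chart_inv_continuous_on[OF \<kappa>] open_chart_image[OF \<kappa>] U
    by (metis continuous_on_open_vimage)
qed

lemma open_image_chart_inv:
  assumes \<kappa>: "is_chart \<kappa>" and V: "open V" "V \<subseteq> snd \<kappa> ` fst \<kappa>"
  shows "open (chart_inv \<kappa> ` V)"
proof -
  have "chart_inv \<kappa> ` V = snd \<kappa> -` V \<inter> fst \<kappa>"
    using V chart_inv_left[OF \<kappa>] by (force simp: image_iff)
  then show ?thesis
    using chart_continuous_on[OF \<kappa>] open_chart_domain[OF \<kappa>] V
    by (metis continuous_on_open_vimage)
qed

lemma smooth_atlas_chart: "smooth_atlas A \<Longrightarrow> \<kappa> \<in> A \<Longrightarrow> is_chart \<kappa>"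
  by (simp add: smooth_atlas_def)

lemma smooth_atlas_covers:
  assumes "smooth_atlas A" obtains \<kappa> where "\<kappa> \<in> A" "p \<in> fst \<kappa>"
  using assms unfolding smooth_atlas_def by blast

lemma smooth_atlas_transition:
  "smooth_atlas A \<Longrightarrow> \<kappa> \<in> A \<Longrightarrow> \<kappa>' \<in> A \<Longrightarrow>
    C1_map (snd \<kappa> ` (fst \<kappa> \<inter> fst \<kappa>')) (snd \<kappa>' \<circ> chart_inv \<kappa>)"
  by (simp add: smooth_atlas_def compatible_def smooth_on_imp_C1_map)

text \<open>Turns a change of charts along a curve into the case \<open>id\<close> of the lemmas on
  maps between two manifolds.\<close>

lemma smooth_map_on_id:
  assumes "smooth_atlas A" shows "smooth_map_on A A S id"
  unfolding smooth_map_on_def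
proof
  fix p
  obtain \<kappa> where "\<kappa> \<in> A" "p \<in> fst \<kappa>" using smooth_atlas_covers[OF assms] .
  then show "\<exists>\<kappa>\<in>A. \<exists>\<kappa>'\<in>A. p \<in> fst \<kappa> \<and> id p \<in> fst \<kappa>' \<and>
        (\<exists>W h. open W \<and> snd \<kappa> p \<in> W \<and> smooth_on W h \<and>
           (\<forall>q\<in>S \<inter> fst \<kappa>. snd \<kappa> q \<in> W \<longrightarrow> id q \<in> fst \<kappa>' \<and> snd \<kappa>' (id q) = h (snd \<kappa> q)))"
    by (intro bexI[of _ \<kappa>] conjI exI[of _ UNIV] exI[of _ id]) (auto simp: smooth_on_id)
qed

text \<open>Near each point \<phi> is the composite of a chart, the local smooth extension
  \<open>h\<close> and an inverse chart.\<close>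

lemma smooth_map_on_continuous_on:
  assumes A: "smooth_atlas A" and B: "smooth_atlas B" and \<phi>: "smooth_map_on A B S \<phi>"
  shows "continuous_on S \<phi>"
proof (rule continuous_on_locally)
  fix p assume "p \<in> S"
  with \<phi> obtain \<kappa> \<kappa>' W h where *: "\<kappa> \<in> A" "\<kappa>' \<in> B" "p \<in> fst \<kappa>" "open W" "snd \<kappa> p \<in> W"
      "smooth_on W h" "\<forall>q\<in>S \<inter> fst \<kappa>. snd \<kappa> q \<in> W \<longrightarrow> \<phi> q \<in> fst \<kappa>' \<and> snd \<kappa>' (\<phi> q) = h (snd \<kappa> q)"
    unfolding smooth_map_on_def by meson
  note \<kappa> = smooth_atlas_chart[OF A *(1)] and \<kappa>' = smooth_atlas_chart[OF B *(2)]
  define T where "T = snd \<kappa> -` W \<inter> fst \<kappa>"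
  have T: "open T" "p \<in> T"
    using * chart_continuous_on[OF \<kappa>] open_chart_domain[OF \<kappa>]
    by (auto simp: T_def continuous_on_open_vimage)
  have eq: "\<phi> q = chart_inv \<kappa>' (h (snd \<kappa> q))" "h (snd \<kappa> q) \<in> snd \<kappa>' ` fst \<kappa>'"
    if "q \<in> S \<inter> T" for q
  proof -
    have "\<phi> q \<in> fst \<kappa>'" "snd \<kappa>' (\<phi> q) = h (snd \<kappa> q)" using that * by (auto simp: T_def)
    then show "\<phi> q = chart_inv \<kappa>' (h (snd \<kappa> q))" "h (snd \<kappa> q) \<in> snd \<kappa>' ` fst \<kappa>'"
      using chart_inv_left[OF \<kappa>'] by (metis, metis imageI)
  qed
  have "continuous_on (S \<inter> T) (\<lambda>q. chart_inv \<kappa>' (h (snd \<kappa> q)))"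
  proof (rule continuous_on_compose2[OF chart_inv_continuous_on[OF \<kappa>']])
    show "continuous_on (S \<inter> T) (\<lambda>q. h (snd \<kappa> q))"
      by (rule continuous_on_compose2[OF C1_map_continuous_on[OF smooth_on_imp_C1_map[OF *(6)]]])
        (auto simp: T_def intro: continuous_on_subset[OF chart_continuous_on[OF \<kappa>]])
    show "(\<lambda>q. h (snd \<kappa> q)) ` (S \<inter> T) \<subseteq> snd \<kappa>' ` fst \<kappa>'" using eq by blast
  qed
  moreover have "continuous_on (S \<inter> T) \<phi> = continuous_on (S \<inter> T) (\<lambda>q. chart_inv \<kappa>' (h (snd \<kappa> q)))"
    by (rule continuous_on_cong[OF refl eq(1)])
  ultimately have "continuous_on (S \<inter> T) \<phi>" by blast
  with T show "\<exists>T. open T \<and> p \<in> T \<and> continuous_on (S \<inter> T) \<phi>" by blast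
qed

lemma open_coordinate_domain:
  assumes A: "smooth_atlas A" and B: "smooth_atlas B" and \<phi>: "smooth_map_on A B S \<phi>"
    and U: "open U" "U \<subseteq> S" and \<kappa>: "\<kappa> \<in> A" "\<kappa>' \<in> B"
  shows "open (fst \<kappa> \<inter> U \<inter> \<phi> -` fst \<kappa>')"
proof -
  have "continuous_on (fst \<kappa> \<inter> U) \<phi>"
    using smooth_map_on_continuous_on[OF A B \<phi>] U by (meson continuous_on_subset inf_le2 order_trans)
  moreover have "open (fst \<kappa> \<inter> U)" "open (fst \<kappa>')"
    using \<kappa> A B U smooth_atlas_chart open_chart_domain by blast+
  ultimately have "open (\<phi> -` fst \<kappa>' \<inter> (fst \<kappa> \<inter> U))"
    using continuous_on_open_vimage by blast
  then show ?thesis by (simp add: Int_ac)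
qed

text \<open>\<open>smooth_map_on\<close> offers one suitable pair of charts at each point, whereas
  metrics and curves are tested in every chart of the atlas. Transition maps on both sides carry the
  regularity over to an arbitrary pair.\<close>

lemma C1_map_coordinates:
  assumes A: "smooth_atlas A" and B: "smooth_atlas B" and \<phi>: "smooth_map_on A B S \<phi>"
    and U: "open U" "U \<subseteq> S" and \<kappa>: "\<kappa> \<in> A" "\<kappa>' \<in> B"
  shows "C1_map (snd \<kappa> ` (fst \<kappa> \<inter> U \<inter> \<phi> -` fst \<kappa>')) (snd \<kappa>' \<circ> \<phi> \<circ> chart_inv \<kappa>)"
proof (rule C1_map_locally)
  note ch = smooth_atlas_chart[OF A \<kappa>(1)] and ch' = smooth_atlas_chart[OF B \<kappa>(2)]
  let ?P = "fst \<kappa> \<inter> U \<inter> \<phi> -` fst \<kappa>'"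
  fix x assume "x \<in> snd \<kappa> ` ?P"
  then obtain p where p: "p \<in> ?P" "x = snd \<kappa> p" by blast
  have "p \<in> S" using p U by blast
  with \<phi> obtain \<mu> \<mu>' W h where *: "\<mu> \<in> A" "\<mu>' \<in> B" "p \<in> fst \<mu>" "open W" "snd \<mu> p \<in> W"
      "smooth_on W h" "\<forall>q\<in>S \<inter> fst \<mu>. snd \<mu> q \<in> W \<longrightarrow> \<phi> q \<in> fst \<mu>' \<and> snd \<mu>' (\<phi> q) = h (snd \<mu> q)"
    unfolding smooth_map_on_def by meson
  note \<mu> = smooth_atlas_chart[OF A *(1)] and \<mu>' = smooth_atlas_chart[OF B *(2)]
  define Q where "Q = ?P \<inter> (snd \<mu> -` W \<inter> fst \<mu>)"
  have "open (snd \<mu> -` W \<inter> fst \<mu>)"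
    using * chart_continuous_on[OF \<mu>] open_chart_domain[OF \<mu>] by (auto simp: continuous_on_open_vimage)
  then have "open Q"
    unfolding Q_def using open_coordinate_domain[OF A B \<phi> U \<kappa>] by blast
  then have T: "open (snd \<kappa> ` Q)" using open_image_chart[OF ch] by (simp add: Q_def le_infI1)
  have xT: "x \<in> snd \<kappa> ` Q" using p * by (auto simp: Q_def)
  have Q: "q \<in> fst \<kappa>" "q \<in> fst \<mu>" "q \<in> U" "\<phi> q \<in> fst \<kappa>'" "\<phi> q \<in> fst \<mu>'" "snd \<mu> q \<in> W"
    "snd \<mu>' (\<phi> q) = h (snd \<mu> q)" if "q \<in> Q" for q
    using that U * by (auto simp: Q_def)
  \<comment> \<open>The expression of \<phi> in the given charts, factored through the pair
    \<open>\<mu>\<close>, \<open>\<mu>'\<close> in which the smooth extension \<open>h\<close> is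
    available.\<close>
  define k where "k = (snd \<kappa>' \<circ> chart_inv \<mu>') \<circ> (h \<circ> (snd \<mu> \<circ> chart_inv \<kappa>))"
  have "C1_map (snd \<kappa> ` Q) k"
    unfolding k_def
  proof (rule C1_map_compose, rule C1_map_compose)
    show "C1_map (snd \<kappa> ` Q) (snd \<mu> \<circ> chart_inv \<kappa>)"
      by (rule C1_map_subset[OF smooth_atlas_transition[OF A \<kappa>(1) *(1)]]) (use Q in auto)
    show "C1_map W h" using * smooth_on_imp_C1_map by blast
    show "(snd \<mu> \<circ> chart_inv \<kappa>) ` snd \<kappa> ` Q \<subseteq> W"
      using Q chart_inv_left[OF ch] by auto
    show "C1_map (snd \<mu>' ` (fst \<mu>' \<inter> fst \<kappa>')) (snd \<kappa>' \<circ> chart_inv \<mu>')"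
      by (rule smooth_atlas_transition[OF B *(2) \<kappa>(2)])
    show "(h \<circ> (snd \<mu> \<circ> chart_inv \<kappa>)) ` snd \<kappa> ` Q \<subseteq> snd \<mu>' ` (fst \<mu>' \<inter> fst \<kappa>')"
    proof clarsimp
      fix q assume "q \<in> Q"
      then show "h (snd \<mu> (chart_inv \<kappa> (snd \<kappa> q))) \<in> snd \<mu>' ` (fst \<mu>' \<inter> fst \<kappa>')"
        using Q[of q] chart_inv_left[OF ch, of q] by (metis IntI imageI)
    qed
  qed
  then have "C1_map (snd \<kappa> ` Q) (snd \<kappa>' \<circ> \<phi> \<circ> chart_inv \<kappa>)"
  proof (rule C1_map_cong[OF _ T])
    fix y assume "y \<in> snd \<kappa> ` Q"
    then obtain q where q: "q \<in> Q" "y = snd \<kappa> q" by blast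
    have "chart_inv \<mu>' (h (snd \<mu> q)) = \<phi> q" using Q[OF q(1)] chart_inv_left[OF \<mu>'] by metis
    then show "k y = (snd \<kappa>' \<circ> \<phi> \<circ> chart_inv \<kappa>) y"
      using q Q[OF q(1)] chart_inv_left[OF ch] by (simp add: k_def)
  qed
  then have "C1_map (snd \<kappa> ` ?P \<inter> snd \<kappa> ` Q) (snd \<kappa>' \<circ> \<phi> \<circ> chart_inv \<kappa>)"
    by (rule C1_map_subset) auto
  then show "\<exists>T. open T \<and> x \<in> T \<and> C1_map (snd \<kappa> ` ?P \<inter> T) (snd \<kappa>' \<circ> \<phi> \<circ> chart_inv \<kappa>)"
    using T xT by blast
qed

text \<open>At an interior point the coordinate image of \<open>S\<close> is a neighbourhood, so the
  derivative within it is the unrestricted one.\<close>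

lemma differential_interior:
  assumes "is_chart \<kappa>" "p \<in> fst \<kappa>" "open U" "p \<in> U" "U \<subseteq> S"
  shows "differential \<kappa> \<kappa>' S \<phi> p = frechet_derivative (snd \<kappa>' \<circ> \<phi> \<circ> chart_inv \<kappa>) (at (snd \<kappa> p))"
proof -
  have o: "open (snd \<kappa> ` (fst \<kappa> \<inter> U))"
    using assms open_chart_domain[OF assms(1)] by (intro open_image_chart) auto
  have "at (snd \<kappa> p) within snd \<kappa> ` (fst \<kappa> \<inter> S) = at (snd \<kappa> p)"
    by (rule at_within_nhd[OF _ o]) (use assms in auto)
  then show ?thesis by (simp add: differential_def)
qed

section \<open>Curves\<close>

lemma curve_preimage_open:
  assumes "continuous_on {a..b::real} \<gamma>" "open U"
  obtains T where "open T" "T \<inter> {a..b} = {a..b} \<inter> \<gamma> -` U"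
  using assms unfolding continuous_on_open_invariant by (metis Int_commute)

lemma curve_coordinate_derivative:
  fixes \<gamma> :: "real \<Rightarrow> 'a::topological_space"
  assumes A: "smooth_atlas A" and B: "smooth_atlas B" and \<phi>: "smooth_map_on A B S \<phi>"
    and U: "open U" "U \<subseteq> S" and \<kappa>: "\<kappa> \<in> A" "\<kappa>' \<in> B"
    and \<gamma>: "continuous_on {a..b} \<gamma>"
    and t: "t \<in> {a..b}" "\<gamma> t \<in> fst \<kappa>" "\<gamma> t \<in> U" "\<phi> (\<gamma> t) \<in> fst \<kappa>'"
    and v: "(snd \<kappa> \<circ> \<gamma> has_vector_derivative v) (at t within {a..b})"
  shows "(snd \<kappa>' \<circ> (\<phi> \<circ> \<gamma>) has_vector_derivative differential \<kappa> \<kappa>' S \<phi> (\<gamma> t) v) (at t within {a..b})"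
proof -
  note ch = smooth_atlas_chart[OF A \<kappa>(1)]
  let ?\<Phi> = "snd \<kappa>' \<circ> \<phi> \<circ> chart_inv \<kappa>"
  have "(?\<Phi> has_derivative frechet_derivative ?\<Phi> (at (snd \<kappa> (\<gamma> t)))) (at (snd \<kappa> (\<gamma> t)))"
    by (rule C1_map_has_derivative[OF C1_map_coordinates[OF A B \<phi> U \<kappa>]]) (use t in auto)
  then have d: "(?\<Phi> has_derivative differential \<kappa> \<kappa>' S \<phi> (\<gamma> t)) (at ((snd \<kappa> \<circ> \<gamma>) t))"
    by (simp add: differential_interior[OF ch t(2) U(1) t(3) U(2)])
  have hv: "((\<lambda>s. ?\<Phi> ((snd \<kappa> \<circ> \<gamma>) s)) has_vector_derivative differential \<kappa> \<kappa>' S \<phi> (\<gamma> t) v) (at t within {a..b})"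
    using has_derivative_compose[OF v[unfolded has_vector_derivative_def] d]
      linear_scale[OF has_derivative_linear[OF d]]
    by (simp add: has_vector_derivative_def)
  \<comment> \<open>\<open>chart_inv \<kappa>\<close> undoes \<open>snd \<kappa>\<close> only while
    the curve is in the chart domain, so the two curves agree merely for times near
    \<open>t\<close>.\<close>
  obtain T where T: "open T" "T \<inter> {a..b} = {a..b} \<inter> \<gamma> -` fst \<kappa>"
    using curve_preimage_open[OF \<gamma> open_chart_domain[OF ch]] .
  obtain e where e: "e > 0" "ball t e \<subseteq> T"
    using T t open_contains_ball by blast
  show ?thesis
  proof (rule has_vector_derivative_transform_within[OF hv e(1) t(1)])
    fix s assume "s \<in> {a..b}" "dist s t < e"
    then have "s \<in> T \<inter> {a..b}" using e by (auto simp: dist_commute)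
    then have "\<gamma> s \<in> fst \<kappa>" using T by blast
    then show "?\<Phi> ((snd \<kappa> \<circ> \<gamma>) s) = (snd \<kappa>' \<circ> (\<phi> \<circ> \<gamma>)) s" by (simp add: chart_inv_left[OF ch])
  qed
qed

lemma C1_curve_on_image:
  fixes \<gamma> :: "real \<Rightarrow> 'a::topological_space"
  assumes A: "smooth_atlas A" and B: "smooth_atlas B" and \<phi>: "smooth_map_on A B S \<phi>"
    and U: "open U" "U \<subseteq> S" and \<gamma>: "C1_curve_on A a b \<gamma>" "\<gamma> ` {a..b} \<subseteq> U" and "a < b"
  shows "C1_curve_on B a b (\<phi> \<circ> \<gamma>)"
  unfolding C1_curve_on_def
proof (intro conjI ballI)
  have c\<gamma>: "continuous_on {a..b} \<gamma>" using \<gamma> by (simp add: C1_curve_on_def)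
  show c: "continuous_on {a..b} (\<phi> \<circ> \<gamma>)"
    using smooth_map_on_continuous_on[OF A B \<phi>] c\<gamma> \<gamma>(2) U
    by (meson continuous_on_compose continuous_on_subset order_trans)
  fix \<kappa>' assume \<kappa>': "\<kappa>' \<in> B"
  let ?P = "{a..b} \<inter> (\<phi> \<circ> \<gamma>) -` fst \<kappa>'"
  \<comment> \<open>One chart of the source need not contain the whole part of the curve that is
    mapped into \<open>\<kappa>'\<close>. A candidate defined without reference to source charts
    allows existence and continuity to be checked near each time separately.\<close>
  let ?D = "\<lambda>t. vector_derivative (snd \<kappa>' \<circ> (\<phi> \<circ> \<gamma>)) (at t within {a..b})"
  have main: "(snd \<kappa>' \<circ> (\<phi> \<circ> \<gamma>) has_vector_derivative ?D t) (at t within {a..b}) \<and>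
     (\<exists>T. open T \<and> t \<in> T \<and> continuous_on (?P \<inter> T) ?D)" if t: "t \<in> ?P" for t
  proof -
    obtain \<kappa> where \<kappa>: "\<kappa> \<in> A" "\<gamma> t \<in> fst \<kappa>" using smooth_atlas_covers[OF A] .
    note ch = smooth_atlas_chart[OF A \<kappa>(1)]
    obtain D where D: "continuous_on ({a..b} \<inter> \<gamma> -` fst \<kappa>) D"
      "\<And>s. s \<in> {a..b} \<inter> \<gamma> -` fst \<kappa> \<Longrightarrow> (snd \<kappa> \<circ> \<gamma> has_vector_derivative D s) (at s within {a..b})"
      using \<gamma> \<kappa> by (auto simp: C1_curve_on_def)
    obtain T where T: "open T" "T \<inter> {a..b} = {a..b} \<inter> \<gamma> -` fst \<kappa>"
      using curve_preimage_open[OF c\<gamma> open_chart_domain[OF ch]] .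
    let ?\<Phi> = "snd \<kappa>' \<circ> \<phi> \<circ> chart_inv \<kappa>"
    have s: "(snd \<kappa>' \<circ> (\<phi> \<circ> \<gamma>) has_vector_derivative
         frechet_derivative ?\<Phi> (at (snd \<kappa> (\<gamma> s))) (D s)) (at s within {a..b})"
      if "s \<in> ?P \<inter> T" for s
    proof -
      have s: "s \<in> {a..b}" "\<gamma> s \<in> fst \<kappa>" "\<gamma> s \<in> U" "\<phi> (\<gamma> s) \<in> fst \<kappa>'"
        using that T \<gamma>(2) by auto
      show ?thesis
        using curve_coordinate_derivative[OF A B \<phi> U \<kappa>(1) \<kappa>' c\<gamma> s D(2)] s
        by (simp add: differential_interior[OF ch s(2) U(1) s(3) U(2)])
    qed
    \<comment> \<open>Derivatives within \<open>{a..b}\<close> are unique because the interval is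
      nondegenerate; this is where \<open>a < b\<close> enters.\<close>
    have eq: "?D s = frechet_derivative ?\<Phi> (at (snd \<kappa> (\<gamma> s))) (D s)" if "s \<in> ?P \<inter> T" for s
      using vector_derivative_within_cbox[of a b s, OF \<open>a < b\<close>] s[OF that] that by simp
    have "continuous_on (?P \<inter> T) (\<lambda>s. frechet_derivative ?\<Phi> (at (snd \<kappa> (\<gamma> s))) (D s))"
    proof (rule continuous_on_frechet_derivative[OF C1_map_coordinates[OF A B \<phi> U \<kappa>(1) \<kappa>']])
      show "continuous_on (?P \<inter> T) D" by (rule continuous_on_subset[OF D(1)]) (use T in auto)
      show "continuous_on (?P \<inter> T) (\<lambda>s. snd \<kappa> (\<gamma> s))"
        by (rule continuous_on_compose2[OF chart_continuous_on[OF ch]])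
          (use T in \<open>auto intro: continuous_on_subset[OF c\<gamma>]\<close>)
      show "(\<lambda>s. snd \<kappa> (\<gamma> s)) ` (?P \<inter> T) \<subseteq> snd \<kappa> ` (fst \<kappa> \<inter> U \<inter> \<phi> -` fst \<kappa>')"
        using T \<gamma>(2) by (auto intro!: imageI)
    qed
    moreover have "continuous_on (?P \<inter> T) ?D =
        continuous_on (?P \<inter> T) (\<lambda>s. frechet_derivative ?\<Phi> (at (snd \<kappa> (\<gamma> s))) (D s))"
      by (rule continuous_on_cong[OF refl eq])
    ultimately have "continuous_on (?P \<inter> T) ?D" by blast
    moreover have "t \<in> T" using T t \<kappa> by blast
    moreover have "?D t = frechet_derivative ?\<Phi> (at (snd \<kappa> (\<gamma> t))) (D t)"
      by (rule eq) (use t \<open>t \<in> T\<close> in blast)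
    ultimately show ?thesis using T s[of t] t by (metis IntI)
  qed
  show "\<exists>D. continuous_on ?P D \<and> (\<forall>t\<in>?P. (snd \<kappa>' \<circ> (\<phi> \<circ> \<gamma>) has_vector_derivative D t) (at t within {a..b}))"
    using main by (intro exI[of _ ?D] conjI continuous_on_locally) blast+
qed

text \<open>The condition of \<open>piecewise_C1_curve\<close> on an arbitrary interval, so that
  curves can be cut and joined before they are rescaled to \<open>{0..1}\<close>.\<close>

definition piecewise_C1_on ::
  "('a::topological_space, 'e::euclidean_space) chart set \<Rightarrow> real \<Rightarrow> real \<Rightarrow> (real \<Rightarrow> 'a) \<Rightarrow> bool" where
  "piecewise_C1_on A a b \<gamma> \<longleftrightarrow> continuous_on {a..b} \<gamma> \<and>
     (\<exists>S. finite S \<and>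
        (\<forall>c d. a \<le> c \<and> c < d \<and> d \<le> b \<and> {c<..<d} \<inter> S = {} \<longrightarrow> C1_curve_on A c d \<gamma>))"

lemma piecewise_C1_curve_iff: "piecewise_C1_curve A \<gamma> \<longleftrightarrow> piecewise_C1_on A 0 1 \<gamma>"
  by (simp add: piecewise_C1_curve_def piecewise_C1_on_def path_def)

text \<open>Handles rescaling, time reversal (\<open>c = -1\<close>) and restriction to a
  subinterval (\<open>c = 1\<close>, \<open>d = 0\<close>) at once; for the last purpose the affine
  map goes into, not onto, the interval of \<gamma>.\<close>

lemma C1_curve_on_affine:
  assumes \<gamma>: "C1_curve_on A a' b' \<gamma>" and f: "\<And>t. t \<in> {a..b} \<Longrightarrow> c * t + d \<in> {a'..b'}"
  shows "C1_curve_on A a b (\<lambda>t. \<gamma> (c * t + d))"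
  unfolding C1_curve_on_def
proof (intro conjI ballI)
  have f': "(\<lambda>t. c * t + d) ` {a..b} \<subseteq> {a'..b'}" using f by blast
  have cont: "continuous_on X (\<lambda>t::real. c * t + d)" for X by (intro continuous_intros)
  show "continuous_on {a..b} (\<lambda>t. \<gamma> (c * t + d))"
    using \<gamma> by (intro continuous_on_compose2[OF _ cont f']) (simp add: C1_curve_on_def)
  fix \<kappa> assume "\<kappa> \<in> A"
  with \<gamma> obtain D where D: "continuous_on ({a'..b'} \<inter> \<gamma> -` fst \<kappa>) D"
    "\<And>t. t \<in> {a'..b'} \<inter> \<gamma> -` fst \<kappa> \<Longrightarrow> (snd \<kappa> \<circ> \<gamma> has_vector_derivative D t) (at t within {a'..b'})"
    by (auto simp: C1_curve_on_def)
  let ?P = "{a..b} \<inter> (\<lambda>t. \<gamma> (c * t + d)) -` fst \<kappa>"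
  have "continuous_on ?P (\<lambda>t. c *\<^sub>R D (c * t + d))"
    using f by (intro continuous_on_scaleR continuous_on_const continuous_on_compose2[OF D(1) cont]) blast
  moreover have "(snd \<kappa> \<circ> (\<lambda>t. \<gamma> (c * t + d)) has_vector_derivative c *\<^sub>R D (c * t + d)) (at t within {a..b})"
    if t: "t \<in> ?P" for t
  proof -
    have "((\<lambda>t. c * t + d) has_vector_derivative c) (at t within {a..b})"
      by (auto intro!: derivative_eq_intros simp: has_real_derivative_iff_has_vector_derivative[symmetric])
    moreover have "(snd \<kappa> \<circ> \<gamma> has_vector_derivative D (c * t + d)) (at (c * t + d) within (\<lambda>t. c * t + d) ` {a..b})"
      using t f by (intro has_vector_derivative_within_subset[OF D(2) f']) blast
    ultimately show ?thesis
      using vector_diff_chain_within by (fastforce simp: o_def)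
  qed
  ultimately show "\<exists>D. continuous_on ?P D \<and>
      (\<forall>t\<in>?P. (snd \<kappa> \<circ> (\<lambda>t. \<gamma> (c * t + d)) has_vector_derivative D t) (at t within {a..b}))"
    by blast
qed

lemma C1_curve_on_subset:
  "C1_curve_on A a b \<gamma> \<Longrightarrow> {c..d} \<subseteq> {a..b} \<Longrightarrow> C1_curve_on A c d \<gamma>"
  using C1_curve_on_affine[where a'=a and b'=b and c=1 and d=0 and a=c and b=d] by (simp add: subset_iff)

lemma C1_curve_on_cong:
  assumes "\<And>t. t \<in> {a..b} \<Longrightarrow> \<gamma> t = \<delta> t" "C1_curve_on A a b \<gamma>"
  shows "C1_curve_on A a b \<delta>"
  unfolding C1_curve_on_def
proof (intro conjI ballI)
  show "continuous_on {a..b} \<delta>"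
    using assms continuous_on_eq[of "{a..b}" \<gamma> \<delta>] unfolding C1_curve_on_def by blast
  fix \<kappa> assume "\<kappa> \<in> A"
  with assms(2) obtain D where D: "continuous_on ({a..b} \<inter> \<gamma> -` fst \<kappa>) D"
    "\<And>t. t \<in> {a..b} \<inter> \<gamma> -` fst \<kappa> \<Longrightarrow> (snd \<kappa> \<circ> \<gamma> has_vector_derivative D t) (at t within {a..b})"
    by (auto simp: C1_curve_on_def)
  have "{a..b} \<inter> \<gamma> -` fst \<kappa> = {a..b} \<inter> \<delta> -` fst \<kappa>" using assms(1) by auto
  moreover have "(snd \<kappa> \<circ> \<delta> has_vector_derivative D t) (at t within {a..b})"
    if "t \<in> {a..b} \<inter> \<gamma> -` fst \<kappa>" for t
    using that assms(1) by (intro has_vector_derivative_weaken[OF D(2)[OF that]]) auto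
  ultimately show "\<exists>D. continuous_on ({a..b} \<inter> \<delta> -` fst \<kappa>) D \<and>
      (\<forall>t\<in>{a..b} \<inter> \<delta> -` fst \<kappa>. (snd \<kappa> \<circ> \<delta> has_vector_derivative D t) (at t within {a..b}))"
    using D(1) by (intro exI[of _ D]) auto
qed

lemma C1_curve_on_imp_piecewise:
  "C1_curve_on A a b \<gamma> \<Longrightarrow> piecewise_C1_on A a b \<gamma>"
  unfolding piecewise_C1_on_def
  by (auto simp: C1_curve_on_def[of A a b] intro!: exI[of _ "{}"])
    (metis C1_curve_on_def C1_curve_on_subset atLeastatMost_subset_iff)

lemma piecewise_C1_on_cong:
  assumes "\<And>t. t \<in> {a..b} \<Longrightarrow> \<gamma> t = \<delta> t" "piecewise_C1_on A a b \<gamma>"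
  shows "piecewise_C1_on A a b \<delta>"
proof -
  have "continuous_on {a..b} \<delta>"
    using assms continuous_on_eq[of "{a..b}" \<gamma> \<delta>] unfolding piecewise_C1_on_def by blast
  moreover obtain S where "finite S"
    "\<And>c d. a \<le> c \<and> c < d \<and> d \<le> b \<and> {c<..<d} \<inter> S = {} \<Longrightarrow> C1_curve_on A c d \<gamma>"
    using assms(2) by (auto simp: piecewise_C1_on_def)
  then have "finite S \<and> (\<forall>c d. a \<le> c \<and> c < d \<and> d \<le> b \<and> {c<..<d} \<inter> S = {} \<longrightarrow> C1_curve_on A c d \<delta>)"
    using assms(1) by (auto intro!: C1_curve_on_cong[of _ _ \<gamma> \<delta>])
  ultimately show ?thesis unfolding piecewise_C1_on_def by blast
qed

text \<open>The new break points are the preimages of the old ones; they are finitely many because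
  \<open>c \<noteq> 0\<close> makes the affine map injective.\<close>

lemma piecewise_C1_on_affine:
  assumes \<gamma>: "piecewise_C1_on A a' b' \<gamma>" and f: "\<And>t. t \<in> {a..b} \<Longrightarrow> c * t + d \<in> {a'..b'}" and "c \<noteq> 0"
  shows "piecewise_C1_on A a b (\<lambda>t. \<gamma> (c * t + d))"
proof -
  let ?f = "\<lambda>t. c * t + d"
  obtain S where S: "finite S"
    "\<And>c d. a' \<le> c \<and> c < d \<and> d \<le> b' \<and> {c<..<d} \<inter> S = {} \<Longrightarrow> C1_curve_on A c d \<gamma>"
    using \<gamma> by (auto simp: piecewise_C1_on_def)
  have "continuous_on {a..b} (\<lambda>t. \<gamma> (?f t))"
  proof (rule continuous_on_compose2[of "{a'..b'}" \<gamma>])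
    show "continuous_on {a'..b'} \<gamma>" using \<gamma> by (simp add: piecewise_C1_on_def)
    show "?f ` {a..b} \<subseteq> {a'..b'}" using f by blast
  qed (intro continuous_intros)
  moreover have "finite (?f -` S)"
    using \<open>c \<noteq> 0\<close> by (intro finite_vimageI S injI) auto
  moreover have "C1_curve_on A u v (\<lambda>t. \<gamma> (?f t))"
    if uv: "a \<le> u" "u < v" "v \<le> b" "{u<..<v} \<inter> ?f -` S = {}" for u v
  proof -
    \<comment> \<open>The sign of \<open>c\<close> is open, so the images of \<open>u\<close> and
      \<open>v\<close> may come in either order.\<close>
    let ?l = "min (?f u) (?f v)" and ?h = "max (?f u) (?f v)"
    have "?f u \<in> {a'..b'}" "?f v \<in> {a'..b'}" using uv by (intro f; simp)+
    moreover have "?l < ?h" using uv \<open>c \<noteq> 0\<close> by (auto simp: min_def max_def)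
    moreover have "{?l<..<?h} \<inter> S = {}"
    proof -
      have "x \<notin> S" if x: "x \<in> {?l<..<?h}" for x
      proof -
        have xf: "x = ?f ((x - d) / c)" using \<open>c \<noteq> 0\<close> by simp
        moreover have "(x - d) / c \<in> {u<..<v}"
        proof (cases "c > 0")
          case True
          then have "?f u < ?f v" using uv by simp
          then show ?thesis using x True by (auto simp: field_simps min_def max_def)
        next
          case False
          then have "c < 0" using \<open>c \<noteq> 0\<close> by simp
          then have "?f v < ?f u" using uv by simp
          then show ?thesis using x \<open>c < 0\<close> by (auto simp: field_simps min_def max_def)
        qed
        ultimately show ?thesis using uv(4) by auto
      qed
      then show ?thesis by blast
    qed
    ultimately have C: "C1_curve_on A ?l ?h \<gamma>" by (intro S(2)) auto
    show ?thesis
    proof (rule C1_curve_on_affine[OF C])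
      fix t assume "t \<in> {u..v}"
      then show "?f t \<in> {?l..?h}"
        using mult_left_mono[of u t c] mult_left_mono[of t v c]
          mult_left_mono_neg[of u t c] mult_left_mono_neg[of t v c]
        by (cases "c \<ge> 0") (auto simp: min_def max_def)
    qed
  qed
  ultimately show ?thesis unfolding piecewise_C1_on_def by blast
qed

lemma piecewise_C1_on_subset:
  "piecewise_C1_on A a b \<gamma> \<Longrightarrow> {c..d} \<subseteq> {a..b} \<Longrightarrow> piecewise_C1_on A c d \<gamma>"
  using piecewise_C1_on_affine[where a'=a and b'=b and c=1 and d=0 and a=c and b=d] by (simp add: subset_iff)

lemma piecewise_C1_on_combine:
  assumes "piecewise_C1_on A a b \<gamma>" "piecewise_C1_on A b c \<gamma>" "a \<le> b" "b \<le> c"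
  shows "piecewise_C1_on A a c \<gamma>"
proof -
  obtain S where S: "finite S"
    "\<And>u v. a \<le> u \<and> u < v \<and> v \<le> b \<and> {u<..<v} \<inter> S = {} \<Longrightarrow> C1_curve_on A u v \<gamma>"
    using assms(1) by (auto simp: piecewise_C1_on_def)
  obtain T where T: "finite T"
    "\<And>u v. b \<le> u \<and> u < v \<and> v \<le> c \<and> {u<..<v} \<inter> T = {} \<Longrightarrow> C1_curve_on A u v \<gamma>"
    using assms(2) by (auto simp: piecewise_C1_on_def)
  have "continuous_on ({a..b} \<union> {b..c}) \<gamma>"
    using assms by (intro continuous_on_closed_Un) (auto simp: piecewise_C1_on_def)
  then have "continuous_on {a..c} \<gamma>" using assms(3,4) by (simp add: ivl_disj_un_two_touch)
  moreover have "C1_curve_on A u v \<gamma>"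
    if uv: "a \<le> u" "u < v" "v \<le> c" "{u<..<v} \<inter> insert b (S \<union> T) = {}" for u v
  proof -
    \<comment> \<open>The junction \<open>b\<close> is itself a break point, so an interval free of
      break points lies on one side of it.\<close>
    have "v \<le> b \<or> b \<le> u" using uv by auto
    then show ?thesis using uv S(2) T(2) by (metis Int_Un_distrib Int_insert_right Un_empty insert_not_empty)
  qed
  ultimately show ?thesis
    unfolding piecewise_C1_on_def using S(1) T(1)
    by (intro conjI exI[of _ "insert b (S \<union> T)"]) auto
qed

lemma piecewise_C1_on_image:
  fixes \<gamma> :: "real \<Rightarrow> 'a::topological_space"
  assumes A: "smooth_atlas A" and B: "smooth_atlas B" and \<phi>: "smooth_map_on A B S \<phi>"
    and U: "open U" "U \<subseteq> S" and \<gamma>: "piecewise_C1_on A a b \<gamma>" "\<gamma> ` {a..b} \<subseteq> U"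
  shows "piecewise_C1_on B a b (\<phi> \<circ> \<gamma>)"
proof -
  have "continuous_on (\<gamma> ` {a..b}) \<phi>"
    by (rule continuous_on_subset[OF smooth_map_on_continuous_on[OF A B \<phi>]]) (use \<gamma>(2) U in blast)
  then have cont: "continuous_on {a..b} (\<phi> \<circ> \<gamma>)"
    using \<gamma>(1) by (intro continuous_on_compose) (simp_all add: piecewise_C1_on_def)
  obtain E where E: "finite E"
    "\<And>u v. a \<le> u \<and> u < v \<and> v \<le> b \<and> {u<..<v} \<inter> E = {} \<Longrightarrow> C1_curve_on A u v \<gamma>"
    using \<gamma>(1) by (auto simp: piecewise_C1_on_def)
  have "C1_curve_on B u v (\<phi> \<circ> \<gamma>)"
    if "a \<le> u" "u < v" "v \<le> b" "{u<..<v} \<inter> E = {}" for u v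
  proof (rule C1_curve_on_image[OF A B \<phi> U E(2) _ that(2)])
    show "\<gamma> ` {u..v} \<subseteq> U" using that \<gamma>(2) by fastforce
  qed (use that in blast)
  with cont E(1) show ?thesis unfolding piecewise_C1_on_def by blast
qed

section \<open>Length\<close>

lemma speed_cong:
  fixes A :: "('a::topological_space, 'e::euclidean_space) chart set"
  assumes "open T" "t \<in> T" "\<And>s. s \<in> T \<Longrightarrow> \<gamma> s = \<delta> s"
  shows "speed A g \<gamma> t = speed A g \<delta> t"
proof -
  have "eventually (\<lambda>s. s \<in> T) (nhds t)" using assms eventually_nhds by blast
  then have "vector_derivative (snd \<kappa> \<circ> \<gamma>) (at t) = vector_derivative (snd \<kappa> \<circ> \<delta>) (at t)"
    for \<kappa> :: "('a, 'e) chart"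
    by (intro vector_derivative_cong_eq) (auto elim!: eventually_mono simp: assms(3))
  then show ?thesis using assms by (simp add: speed_def)
qed

text \<open>Agreement on the closed interval does not control the two-sided derivatives at its ends;
  these two times do not affect the integral.\<close>

lemma integral_speed_cong:
  assumes "\<And>t. t \<in> {a..b} \<Longrightarrow> \<gamma> t = \<delta> t"
  shows "integral {a..b} (speed A g \<gamma>) = integral {a..b} (speed A g \<delta>)"
proof (rule integral_spike[of "{a, b}"])
  fix t assume "t \<in> {a..b} - {a, b}"
  then have "t \<in> {a<..<b}" by auto
  then show "speed A g \<delta> t = speed A g \<gamma> t"
    using assms by (intro speed_cong[of "{a<..<b}"]) auto
qed simp

lemma piecewise_C1_on_derivative:
  assumes "piecewise_C1_on A a b \<gamma>"
  obtains S where "finite S"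
    "\<And>t. t \<in> {a..b} - S \<Longrightarrow> \<exists>u v. t \<in> {u<..<v} \<and> {u..v} \<subseteq> {a..b} \<and> C1_curve_on A u v \<gamma>"
proof -
  obtain S where S: "finite S"
    "\<And>u v. a \<le> u \<and> u < v \<and> v \<le> b \<and> {u<..<v} \<inter> S = {} \<Longrightarrow> C1_curve_on A u v \<gamma>"
    using assms by (auto simp: piecewise_C1_on_def)
  \<comment> \<open>The endpoints join the exceptional set, which leaves room on both sides of
    \<open>t\<close> for an interval free of break points.\<close>
  have "\<exists>u v. t \<in> {u<..<v} \<and> {u..v} \<subseteq> {a..b} \<and> C1_curve_on A u v \<gamma>"
    if t: "t \<in> {a..b} - ({a, b} \<union> S)" for t
  proof -
    have "open (- S \<inter> {a<..<b})" using S(1) by (simp add: finite_imp_closed open_Compl open_Int)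
    then obtain e where e: "e > 0" "cball t e \<subseteq> - S \<inter> {a<..<b}"
      using t unfolding open_contains_cball by force
    then have s: "{t - e..t + e} \<subseteq> - S \<inter> {a<..<b}" by (simp add: cball_eq_atLeastAtMost)
    moreover have "t - e \<in> {t - e..t + e}" "t + e \<in> {t - e..t + e}" using e(1) by auto
    ultimately have "t - e \<in> {a<..<b}" "t + e \<in> {a<..<b}" by blast+
    then have "a \<le> t - e" "t + e \<le> b" by auto
    moreover have "{t - e<..<t + e} \<inter> S = {}"
      using s greaterThanLessThan_subseteq_atLeastAtMost_iff[of "t - e" "t + e" "t - e" "t + e"] by blast
    ultimately show ?thesis
      using e(1) by (intro exI[of _ "t - e"] exI[of _ "t + e"] conjI S(2)) auto
  qed
  then show thesis using S(1) by (intro that[of "{a, b} \<union> S"]) auto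
qed

section \<open>Speed of curves: independence of the chart, integrability, reparametrization\<close>

context
  fixes A :: "('a::t2_space, 'e::euclidean_space) chart set" and g :: "('a, 'e) metric_tensor"
  assumes Ag: "riemannian_manifold A g"
begin

lemma riemannian_manifold_atlas: "smooth_atlas A"
  using Ag by (simp add: riemannian_manifold_def)

lemma metric_bilinear: "\<kappa> \<in> A \<Longrightarrow> p \<in> fst \<kappa> \<Longrightarrow> bilinear (g \<kappa> p)"
  and metric_nonneg: "\<kappa> \<in> A \<Longrightarrow> p \<in> fst \<kappa> \<Longrightarrow> 0 \<le> g \<kappa> p u u"
proof -
  show bil: "\<kappa> \<in> A \<Longrightarrow> p \<in> fst \<kappa> \<Longrightarrow> bilinear (g \<kappa> p)"
    using Ag unfolding riemannian_manifold_def riemannian_metric_def by blast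
  show "\<kappa> \<in> A \<Longrightarrow> p \<in> fst \<kappa> \<Longrightarrow> 0 \<le> g \<kappa> p u u"
    using Ag bil bilinear_lzero[of "g \<kappa> p"] unfolding riemannian_manifold_def riemannian_metric_def
    by (metis less_eq_real_def)
qed

lemma metric_expand:
  assumes "\<kappa> \<in> A" "p \<in> fst \<kappa>"
  shows "g \<kappa> p u w = (\<Sum>b\<in>Basis. \<Sum>c\<in>Basis. (u \<bullet> b) * (w \<bullet> c) * g \<kappa> p b c)"
proof -
  note bil = metric_bilinear[OF assms]
  have "g \<kappa> p u w = g \<kappa> p (\<Sum>b\<in>Basis. (u \<bullet> b) *\<^sub>R b) (\<Sum>c\<in>Basis. (w \<bullet> c) *\<^sub>R c)"
    by (simp add: euclidean_representation)
  also have "\<dots> = (\<Sum>(b,c)\<in>Basis\<times>Basis. g \<kappa> p ((u \<bullet> b) *\<^sub>R b) ((w \<bullet> c) *\<^sub>R c))"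
    by (rule bilinear_sum[OF bil])
  also have "\<dots> = (\<Sum>b\<in>Basis. \<Sum>c\<in>Basis. (u \<bullet> b) * (w \<bullet> c) * g \<kappa> p b c)"
    by (simp add: sum.cartesian_product[symmetric] bilinear_lmul[OF bil] bilinear_rmul[OF bil] mult_ac)
  finally show ?thesis .
qed

lemma metric_components_continuous_on:
  assumes "\<kappa> \<in> A"
  shows "continuous_on (snd \<kappa> ` fst \<kappa>) (\<lambda>x. g \<kappa> (chart_inv \<kappa> x) u v)"
proof -
  have "smooth_on (snd \<kappa> ` fst \<kappa>) (\<lambda>x. g \<kappa> (chart_inv \<kappa> x) u v)"
    using Ag assms unfolding riemannian_manifold_def riemannian_metric_def by blast
  then show ?thesis by (rule C1_map_continuous_on[OF smooth_on_imp_C1_map])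
qed

lemma metric_change_chart:
  assumes "\<kappa> \<in> A" "\<kappa>' \<in> A" "p \<in> fst \<kappa>" "p \<in> fst \<kappa>'"
  shows "g \<kappa>' p (differential \<kappa> \<kappa>' UNIV id p u) (differential \<kappa> \<kappa>' UNIV id p v) = g \<kappa> p u v"
  using Ag assms unfolding riemannian_manifold_def riemannian_metric_def by (metis IntI)

text \<open>The metric is assumed smooth only for fixed arguments \<open>u\<close> and
  \<open>v\<close>; \<open>metric_expand\<close> reduces moving arguments to finitely many fixed
  components.\<close>

lemma continuous_on_metric:
  assumes \<kappa>: "\<kappa> \<in> A" and \<gamma>: "continuous_on T \<gamma>" "\<gamma> ` T \<subseteq> fst \<kappa>" and D: "continuous_on T D"
  shows "continuous_on T (\<lambda>t. g \<kappa> (\<gamma> t) (D t) (D t))"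
proof -
  note ch = smooth_atlas_chart[OF riemannian_manifold_atlas \<kappa>]
  have c: "continuous_on T (\<lambda>t. g \<kappa> (\<gamma> t) b c)" for b c
  proof -
    have "continuous_on T (\<lambda>t. snd \<kappa> (\<gamma> t))"
      by (rule continuous_on_compose2[OF chart_continuous_on[OF ch] \<gamma>])
    then have "continuous_on T (\<lambda>t. g \<kappa> (chart_inv \<kappa> (snd \<kappa> (\<gamma> t))) b c)"
      by (rule continuous_on_compose2[OF metric_components_continuous_on[OF \<kappa>]]) (use \<gamma> in auto)
    moreover have "g \<kappa> (chart_inv \<kappa> (snd \<kappa> (\<gamma> t))) b c = g \<kappa> (\<gamma> t) b c" if "t \<in> T" for t
      using that \<gamma>(2) by (simp add: chart_inv_left[OF ch] image_subset_iff)
    ultimately show ?thesis by (simp cong: continuous_on_cong)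
  qed
  have "continuous_on T (\<lambda>t. \<Sum>b\<in>Basis. \<Sum>c\<in>Basis. (D t \<bullet> b) * (D t \<bullet> c) * g \<kappa> (\<gamma> t) b c)"
    by (intro continuous_intros c D)
  moreover have "g \<kappa> (\<gamma> t) (D t) (D t) = (\<Sum>b\<in>Basis. \<Sum>c\<in>Basis. (D t \<bullet> b) * (D t \<bullet> c) * g \<kappa> (\<gamma> t) b c)"
    if "t \<in> T" for t
    using metric_expand[OF \<kappa>] \<gamma>(2) that by blast
  ultimately show ?thesis by (simp cong: continuous_on_cong)
qed

text \<open>The one-sided speed is continuous up to the endpoints, where \<^const>\<open>speed\<close> may be a junk value.\<close>

lemma C1_curve_on_speed:
  assumes \<gamma>: "C1_curve_on A a b \<gamma>" and "a < b"
  obtains s where "continuous_on {a..b} s"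
    and "\<And>t \<kappa> v. t \<in> {a..b} \<Longrightarrow> \<kappa> \<in> A \<Longrightarrow> \<gamma> t \<in> fst \<kappa> \<Longrightarrow>
       (snd \<kappa> \<circ> \<gamma> has_vector_derivative v) (at t within {a..b}) \<Longrightarrow> s t = sqrt (g \<kappa> (\<gamma> t) v v)"
    and "\<And>t. t \<in> {a<..<b} \<Longrightarrow> s t = speed A g \<gamma> t"
proof -
  note atl = riemannian_manifold_atlas
  \<comment> \<open>The same choice as inside \<open>speed\<close>, so that \<open>s\<close>
    coincides with \<open>speed\<close> wherever the one-sided derivative is two-sided.\<close>
  define ch where "ch t = (SOME \<kappa>. \<kappa> \<in> A \<and> \<gamma> t \<in> fst \<kappa>)" for t
  have ch: "ch t \<in> A" "\<gamma> t \<in> fst (ch t)" for t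
  proof -
    have "\<exists>\<kappa>. \<kappa> \<in> A \<and> \<gamma> t \<in> fst \<kappa>" by (meson smooth_atlas_covers[OF atl])
    from someI_ex[OF this] show "ch t \<in> A" "\<gamma> t \<in> fst (ch t)" by (simp_all add: ch_def)
  qed
  define dv where "dv t = vector_derivative (snd (ch t) \<circ> \<gamma>) (at t within {a..b})" for t
  define s where "s t = sqrt (g (ch t) (\<gamma> t) (dv t) (dv t))" for t
  have c\<gamma>: "continuous_on {a..b} \<gamma>" using \<gamma> by (simp add: C1_curve_on_def)
  have eq: "s t = sqrt (g \<kappa> (\<gamma> t) v v)"
    if t: "t \<in> {a..b}" "\<kappa> \<in> A" "\<gamma> t \<in> fst \<kappa>"
      "(snd \<kappa> \<circ> \<gamma> has_vector_derivative v) (at t within {a..b})" for t \<kappa> v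
  proof -
    \<comment> \<open>A change of charts, read as the coordinate derivative of \<open>id\<close>;
      the transformation law of the metric then makes \<open>s\<close> independent of the
      chart.\<close>
    have "(snd (ch t) \<circ> (id \<circ> \<gamma>) has_vector_derivative differential \<kappa> (ch t) UNIV id (\<gamma> t) v) (at t within {a..b})"
      by (rule curve_coordinate_derivative[OF atl atl smooth_map_on_id[OF atl], of UNIV]) (use t ch c\<gamma> in auto)
    then have "dv t = differential \<kappa> (ch t) UNIV id (\<gamma> t) v"
      unfolding dv_def using vector_derivative_within_closed_interval[OF \<open>a < b\<close> t(1)] by simp
    then show ?thesis using metric_change_chart[OF t(2) ch(1) t(3) ch(2)] by (simp add: s_def)
  qed
  have "continuous_on {a..b} s"
  proof (rule continuous_on_locally)
    fix t assume t: "t \<in> {a..b}"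
    obtain D where D: "continuous_on ({a..b} \<inter> \<gamma> -` fst (ch t)) D"
      "\<And>u. u \<in> {a..b} \<inter> \<gamma> -` fst (ch t) \<Longrightarrow> (snd (ch t) \<circ> \<gamma> has_vector_derivative D u) (at u within {a..b})"
      using \<gamma> ch(1)[of t] by (auto simp: C1_curve_on_def)
    obtain T where T: "open T" "T \<inter> {a..b} = {a..b} \<inter> \<gamma> -` fst (ch t)"
      using curve_preimage_open[OF c\<gamma> open_chart_domain[OF smooth_atlas_chart[OF atl ch(1)]]] .
    \<comment> \<open>The chart \<open>ch u\<close> may jump with \<open>u\<close>. By
      \<open>eq\<close>, near \<open>t\<close> the value of \<open>s\<close> may be computed in the
      single chart \<open>ch t\<close>, where continuity is visible.\<close>
    have "continuous_on ({a..b} \<inter> T) (\<lambda>u. sqrt (g (ch t) (\<gamma> u) (D u) (D u)))"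
      by (intro continuous_on_real_sqrt continuous_on_metric[OF ch(1)])
        (use T D(1) c\<gamma> in \<open>auto simp: Int_commute intro: continuous_on_subset\<close>)
    moreover have "continuous_on ({a..b} \<inter> T) s = continuous_on ({a..b} \<inter> T) (\<lambda>u. sqrt (g (ch t) (\<gamma> u) (D u) (D u)))"
    proof (rule continuous_on_cong[OF refl])
      fix u assume "u \<in> {a..b} \<inter> T"
      then have "u \<in> {a..b} \<inter> \<gamma> -` fst (ch t)" using T by blast
      then show "s u = sqrt (g (ch t) (\<gamma> u) (D u) (D u))" using eq ch(1) D(2) by auto
    qed
    ultimately have "continuous_on ({a..b} \<inter> T) s" by blast
    moreover have "t \<in> T" using T(2) t ch(2)[of t] by blast
    ultimately show "\<exists>T. open T \<and> t \<in> T \<and> continuous_on ({a..b} \<inter> T) s" using T(1) by blast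
  qed
  moreover have "s t = speed A g \<gamma> t" if t: "t \<in> {a<..<b}" for t
  proof -
    have "at t within {a..b} = at t" using t by (simp add: at_within_Icc_at)
    then show ?thesis by (simp add: speed_def s_def dv_def ch_def Let_def)
  qed
  ultimately show thesis using that eq by blast
qed

text \<open>Replaces the chart picked by \<open>SOME\<close> in \<open>speed\<close> by any
  convenient one.\<close>

lemma speed_eq:
  assumes "C1_curve_on A a b \<gamma>" "t \<in> {a<..<b}" "\<kappa> \<in> A" "\<gamma> t \<in> fst \<kappa>"
    "(snd \<kappa> \<circ> \<gamma> has_vector_derivative v) (at t)"
  shows "speed A g \<gamma> t = sqrt (g \<kappa> (\<gamma> t) v v)"
proof -
  have "a < b" using assms by simp
  obtain s where "\<And>t \<kappa> v. t \<in> {a..b} \<Longrightarrow> \<kappa> \<in> A \<Longrightarrow> \<gamma> t \<in> fst \<kappa> \<Longrightarrow>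
       (snd \<kappa> \<circ> \<gamma> has_vector_derivative v) (at t within {a..b}) \<Longrightarrow> s t = sqrt (g \<kappa> (\<gamma> t) v v)"
    "\<And>t. t \<in> {a<..<b} \<Longrightarrow> s t = speed A g \<gamma> t"
    using C1_curve_on_speed[OF assms(1) \<open>a < b\<close>] by metis
  then show ?thesis using assms has_vector_derivative_at_within by (metis atLeastAtMost_iff greaterThanLessThan_iff less_imp_le)
qed

lemma speed_nonneg: "0 \<le> speed A g \<gamma> t"
proof -
  have "\<exists>\<kappa>. \<kappa> \<in> A \<and> \<gamma> t \<in> fst \<kappa>" by (meson smooth_atlas_covers[OF riemannian_manifold_atlas])
  from someI_ex[OF this] show ?thesis
    by (auto simp: speed_def Let_def intro!: metric_nonneg)
qed

lemma C1_curve_on_speed_integrable: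
  assumes "C1_curve_on A a b \<gamma>" "a < b"
  shows "speed A g \<gamma> integrable_on {a..b}"
proof -
  obtain s where s: "continuous_on {a..b} s" "\<And>t. t \<in> {a<..<b} \<Longrightarrow> s t = speed A g \<gamma> t"
    using C1_curve_on_speed[OF assms] by metis
  have eq: "speed A g \<gamma> t = s t" if "t \<in> {a..b} - {a, b}" for t using s(2)[of t] that by auto
  show ?thesis
    by (rule integrable_spike_finite[OF _ eq integrable_continuous_real[OF s(1)], of "{a, b}"]) simp_all
qed

text \<open>Integrability is a local property of the interval, so the break points need not be
  ordered: a short interval around \<open>x\<close> has no break point except possibly
  \<open>x\<close>, and splits there into two C1 pieces.\<close>

lemma piecewise_C1_on_speed_integrable:
  assumes "piecewise_C1_on A a b \<gamma>"
  shows "speed A g \<gamma> integrable_on {a..b}"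
proof -
  obtain S where S: "finite S"
    "\<And>u v. a \<le> u \<and> u < v \<and> v \<le> b \<and> {u<..<v} \<inter> S = {} \<Longrightarrow> C1_curve_on A u v \<gamma>"
    using assms by (auto simp: piecewise_C1_on_def)
  have "speed A g \<gamma> integrable_on cbox a b"
  proof (rule integrable_on_little_subintervals, rule ballI)
    fix x assume "x \<in> cbox a b"
    have "open (- (S - {x}))" by (intro open_Compl finite_imp_closed finite_Diff S(1))
    then obtain e where e: "e > 0" "ball x e \<subseteq> - (S - {x})"
      by (metis ComplI Diff_iff insertI1 open_contains_ball)
    have "speed A g \<gamma> integrable_on {u..v}" if "u \<le> x" "x \<le> v" "{u..v} \<subseteq> ball x e" "{u..v} \<subseteq> {a..b}" for u v
    proof (rule Henstock_Kurzweil_Integration.integrable_combine[OF that(1,2)])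
      have ab: "a \<le> u" "v \<le> b" using that by auto
      have *: "y \<notin> S" if "y \<in> {u..v}" "y \<noteq> x" for y
        using that \<open>{u..v} \<subseteq> ball x e\<close> e by blast
      show "speed A g \<gamma> integrable_on {u..x}"
      proof (cases "u = x")
        case False
        then show ?thesis using * that ab by (intro C1_curve_on_speed_integrable S(2)) auto
      qed (use integrable_on_refl[of _ x] in simp)
      show "speed A g \<gamma> integrable_on {x..v}"
      proof (cases "v = x")
        case False
        then show ?thesis using * that ab by (intro C1_curve_on_speed_integrable S(2)) auto
      qed (use integrable_on_refl[of _ x] in simp)
    qed
    then show "\<exists>d>0. \<forall>u v. x \<in> cbox u v \<and> cbox u v \<subseteq> ball x d \<and> cbox u v \<subseteq> cbox a b \<longrightarrow>
        speed A g \<gamma> integrable_on cbox u v"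
      using e(1) by (intro exI[of _ e]) auto
  qed
  then show ?thesis by simp
qed

text \<open>The speed acquires the factor \<open>\<bar>c\<bar>\<close> and the substitution
  contributes its inverse. The absolute value lets time reversal count as a case.\<close>

lemma integral_speed_affine:
  assumes \<gamma>: "piecewise_C1_on A a' b' \<gamma>" and f: "(\<lambda>t. c * t + d) ` {a..b} = {a'..b'}" and c: "c \<noteq> 0"
  shows "integral {a..b} (speed A g (\<lambda>t. \<gamma> (c * t + d))) = integral {a'..b'} (speed A g \<gamma>)"
proof -
  let ?f = "\<lambda>t. c * t + d" and ?\<delta> = "\<lambda>t. \<gamma> (c * t + d)"
  obtain S where S: "finite S"
    "\<And>t. t \<in> {a'..b'} - S \<Longrightarrow> \<exists>u v. t \<in> {u<..<v} \<and> {u..v} \<subseteq> {a'..b'} \<and> C1_curve_on A u v \<gamma>"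
    using piecewise_C1_on_derivative[OF \<gamma>] by blast
  have fin: "finite (?f -` S)" using c by (intro finite_vimageI S injI) auto
  \<comment> \<open>\<open>has_integral_affinity\<close> integrates over the image of
    \<open>cbox a' b'\<close> under the inverse affine map.\<close>
  have "(\<lambda>x. (1 / c) *\<^sub>R x + - ((1 / c) *\<^sub>R d)) ` cbox a' b' = {a..b}"
    unfolding box_real f[symmetric] image_image using c by (simp add: add_divide_distrib)
  then have "((\<lambda>t. speed A g \<gamma> (?f t)) has_integral (1 / \<bar>c\<bar>) * integral {a'..b'} (speed A g \<gamma>)) {a..b}"
    using has_integral_affinity[of "speed A g \<gamma>" "integral {a'..b'} (speed A g \<gamma>)" a' b' c d] c
      integrable_integral[OF piecewise_C1_on_speed_integrable[OF \<gamma>]] by simp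
  then have int: "((\<lambda>t. \<bar>c\<bar> * speed A g \<gamma> (?f t)) has_integral integral {a'..b'} (speed A g \<gamma>)) {a..b}"
    using has_integral_mult_right[of _ _ "{a..b}" "\<bar>c\<bar>"] c by fastforce
  have eq: "speed A g ?\<delta> t = \<bar>c\<bar> * speed A g \<gamma> (?f t)" if t: "t \<in> {a..b} - ?f -` S" for t
  proof -
    have "?f t \<in> {a'..b'} - S" using t f by blast
    then obtain u v where uv: "?f t \<in> {u<..<v}" "C1_curve_on A u v \<gamma>" using S(2) by blast
    \<comment> \<open>The choice depends only on the point of the manifold, so both speeds are
      computed in this same chart.\<close>
    define \<kappa> where "\<kappa> = (SOME \<kappa>. \<kappa> \<in> A \<and> \<gamma> (?f t) \<in> fst \<kappa>)"
    have "\<exists>\<kappa>. \<kappa> \<in> A \<and> \<gamma> (?f t) \<in> fst \<kappa>" by (meson smooth_atlas_covers[OF riemannian_manifold_atlas])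
    from someI_ex[OF this] have \<kappa>: "\<kappa> \<in> A" "\<gamma> (?f t) \<in> fst \<kappa>" by (simp_all add: \<kappa>_def)
    then obtain D where "(snd \<kappa> \<circ> \<gamma> has_vector_derivative D) (at (?f t) within {u..v})"
      using uv unfolding C1_curve_on_def by fastforce
    then have D: "(snd \<kappa> \<circ> \<gamma> has_vector_derivative D) (at (?f t))"
      using uv(1) by (simp add: at_within_Icc_at)
    have "(?f has_vector_derivative c) (at t)"
      by (auto intro!: derivative_eq_intros simp: has_real_derivative_iff_has_vector_derivative[symmetric])
    from vector_diff_chain_at[OF this D]
    have "(snd \<kappa> \<circ> ?\<delta> has_vector_derivative c *\<^sub>R D) (at t)" by (simp add: o_def)
    then have "speed A g ?\<delta> t = sqrt (g \<kappa> (\<gamma> (?f t)) (c *\<^sub>R D) (c *\<^sub>R D))"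
      by (simp add: speed_def \<kappa>_def[symmetric] vector_derivative_at Let_def)
    also have "\<dots> = sqrt (c\<^sup>2 * g \<kappa> (\<gamma> (?f t)) D D)"
      using metric_bilinear[OF \<kappa>] by (simp add: bilinear_lmul bilinear_rmul power2_eq_square mult.assoc)
    also have "\<dots> = \<bar>c\<bar> * speed A g \<gamma> (?f t)"
      using vector_derivative_at[OF D] by (simp add: real_sqrt_mult speed_def \<kappa>_def[symmetric])
    finally show ?thesis .
  qed
  show ?thesis
    by (rule integral_unique[OF has_integral_spike_finite[OF fin eq int]])
qed

end

section \<open>The Riemannian distance\<close>

definition curve_between ::
  "('a::topological_space, 'e::euclidean_space) chart set \<Rightarrow> 'a \<Rightarrow> 'a \<Rightarrow> (real \<Rightarrow> 'a) \<Rightarrow> bool" where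
  "curve_between A x y \<gamma> \<longleftrightarrow> piecewise_C1_on A 0 1 \<gamma> \<and> \<gamma> 0 = x \<and> \<gamma> 1 = y"

lemma riemannian_dist_eq:
  "riemannian_dist A g x y = Inf (curve_length A g ` {\<gamma>. curve_between A x y \<gamma>})"
  by (simp add: riemannian_dist_def curve_between_def piecewise_C1_curve_iff pathstart_def pathfinish_def)

section \<open>Operations on curves and basic properties of the distance\<close>

context
  fixes A :: "('a::t2_space, 'e::euclidean_space) chart set" and g :: "('a, 'e) metric_tensor"
  assumes Ag: "riemannian_manifold A g"
begin

lemma curve_between_reparametrize:
  assumes \<gamma>: "piecewise_C1_on A a b \<gamma>" and "a < b"
  obtains \<delta> where "curve_between A (\<gamma> a) (\<gamma> b) \<delta>" "curve_length A g \<delta> = integral {a..b} (speed A g \<gamma>)"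
proof -
  have f: "(\<lambda>t. (b - a) * t + a) ` {0..1} = {a..b}"
    unfolding image_affinity_atLeastAtMost using \<open>a < b\<close> by simp
  have "piecewise_C1_on A 0 1 (\<lambda>t. \<gamma> ((b - a) * t + a))"
    using \<open>a < b\<close> by (intro piecewise_C1_on_affine[OF \<gamma>]) (use f in blast, simp)
  moreover have "integral {0..1} (speed A g (\<lambda>t. \<gamma> ((b - a) * t + a))) = integral {a..b} (speed A g \<gamma>)"
    by (rule integral_speed_affine[OF Ag \<gamma> f]) (use \<open>a < b\<close> in simp)
  ultimately show thesis
    by (intro that[of "\<lambda>t. \<gamma> ((b - a) * t + a)"]) (simp_all add: curve_between_def curve_length_def)
qed

lemma curve_between_reverse:
  assumes "curve_between A x y \<gamma>"
  obtains \<delta> where "curve_between A y x \<delta>" "curve_length A g \<delta> = curve_length A g \<gamma>"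
proof -
  have \<gamma>: "piecewise_C1_on A 0 1 \<gamma>" using assms by (simp add: curve_between_def)
  have f: "(\<lambda>t::real. (- 1) * t + 1) ` {0..1} = {0..1}"
    unfolding image_affinity_atLeastAtMost by simp
  have "piecewise_C1_on A 0 1 (\<lambda>t. \<gamma> ((- 1) * t + 1))"
    by (intro piecewise_C1_on_affine[OF \<gamma>]) (use f in blast, simp)
  moreover have "integral {0..1} (speed A g (\<lambda>t. \<gamma> ((- 1) * t + 1))) = integral {0..1} (speed A g \<gamma>)"
    by (rule integral_speed_affine[OF Ag \<gamma> f]) simp
  ultimately show thesis
    using assms by (intro that[of "\<lambda>t. \<gamma> ((- 1) * t + 1)"]) (simp_all add: curve_between_def curve_length_def)
qed

text \<open>The concatenation is first formed on \<open>{0..2}\<close>, where each half keeps its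
  own speed and lengths add up, and only then rescaled. The shift is written
  \<open>1 * t + (- 1)\<close> to match the affine lemmas.\<close>

lemma curve_between_join:
  assumes "curve_between A x y \<gamma>\<^sub>1" "curve_between A y z \<gamma>\<^sub>2"
  obtains \<delta> where "curve_between A x z \<delta>"
    "curve_length A g \<delta> = curve_length A g \<gamma>\<^sub>1 + curve_length A g \<gamma>\<^sub>2"
proof -
  define \<gamma> where "\<gamma> t = (if t \<le> 1 then \<gamma>\<^sub>1 t else \<gamma>\<^sub>2 (1 * t + (- 1)))" for t
  have \<gamma>1: "piecewise_C1_on A 0 1 \<gamma>\<^sub>1" and \<gamma>2: "piecewise_C1_on A 0 1 \<gamma>\<^sub>2" and ends:
    "\<gamma>\<^sub>1 0 = x" "\<gamma>\<^sub>1 1 = y" "\<gamma>\<^sub>2 0 = y" "\<gamma>\<^sub>2 1 = z"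
    using assms by (simp_all add: curve_between_def)
  have f: "(\<lambda>t::real. 1 * t + (- 1)) ` {1..2} = {0..1}"
    unfolding image_affinity_atLeastAtMost by simp
  have eq1: "\<gamma>\<^sub>1 t = \<gamma> t" if "t \<in> {0..1}" for t using that by (simp add: \<gamma>_def)
  have eq2: "\<gamma>\<^sub>2 (1 * t + (- 1)) = \<gamma> t" if "t \<in> {1..2}" for t using that ends by (auto simp: \<gamma>_def)
  have "piecewise_C1_on A 1 2 (\<lambda>t. \<gamma>\<^sub>2 (1 * t + (- 1)))"
    by (rule piecewise_C1_on_affine[OF \<gamma>2]) (use f in blast, simp)
  then have p2: "piecewise_C1_on A 1 2 \<gamma>" by (rule piecewise_C1_on_cong[OF eq2, rotated])
  have p1: "piecewise_C1_on A 0 1 \<gamma>" by (rule piecewise_C1_on_cong[OF eq1 \<gamma>1])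
  have p: "piecewise_C1_on A 0 2 \<gamma>" by (rule piecewise_C1_on_combine[OF p1 p2]) auto
  have "integral {0..1} (speed A g \<gamma>) = curve_length A g \<gamma>\<^sub>1"
    unfolding curve_length_def by (rule integral_speed_cong) (simp add: eq1)
  moreover have "integral {1..2} (speed A g \<gamma>) = curve_length A g \<gamma>\<^sub>2"
    unfolding curve_length_def integral_speed_affine[OF Ag \<gamma>2 f, simplified, symmetric]
    by (rule integral_speed_cong) (use eq2 in simp)
  moreover have "integral {0..1} (speed A g \<gamma>) + integral {1..2} (speed A g \<gamma>) = integral {0..2} (speed A g \<gamma>)"
    by (rule Henstock_Kurzweil_Integration.integral_combine)
      (simp_all add: piecewise_C1_on_speed_integrable[OF Ag p])
  moreover obtain \<delta> where "curve_between A (\<gamma> 0) (\<gamma> 2) \<delta>" "curve_length A g \<delta> = integral {0..2} (speed A g \<gamma>)"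
    using curve_between_reparametrize[OF p] by auto
  moreover have "\<gamma> 0 = x" "\<gamma> 2 = z" using ends by (simp_all add: \<gamma>_def)
  ultimately show thesis by (intro that[of \<delta>]) simp_all
qed

text \<open>Straight segments in one chart are the only curves constructed from scratch. In another
  chart their velocity is the derivative of the transition map in the fixed direction
  \<open>v\<close>.\<close>

lemma chart_segment_curve:
  assumes \<kappa>: "\<kappa> \<in> A" and seg: "\<And>t. t \<in> {0..1} \<Longrightarrow> x + t *\<^sub>R v \<in> snd \<kappa> ` fst \<kappa>"
  shows "C1_curve_on A 0 1 (\<lambda>t. chart_inv \<kappa> (x + t *\<^sub>R v))"
  unfolding C1_curve_on_def
proof (intro conjI ballI)
  note atl = riemannian_manifold_atlas[OF Ag]
  note ch = smooth_atlas_chart[OF atl \<kappa>]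
  let ?l = "\<lambda>t. x + t *\<^sub>R v"
  have cont: "continuous_on T ?l" for T by (intro continuous_intros)
  show "continuous_on {0..1} (\<lambda>t. chart_inv \<kappa> (?l t))"
    by (rule continuous_on_compose2[OF chart_inv_continuous_on[OF ch] cont]) (use seg in blast)
  fix \<kappa>' assume \<kappa>': "\<kappa>' \<in> A"
  let ?P = "{0..1} \<inter> (\<lambda>t. chart_inv \<kappa> (?l t)) -` fst \<kappa>'" and ?\<tau> = "snd \<kappa>' \<circ> chart_inv \<kappa>"
  note \<tau> = smooth_atlas_transition[OF atl \<kappa> \<kappa>']
  have in_dom: "?l t \<in> snd \<kappa> ` (fst \<kappa> \<inter> fst \<kappa>')" if "t \<in> ?P" for t
  proof
    show "?l t = snd \<kappa> (chart_inv \<kappa> (?l t))" using that seg by (simp add: chart_inv_right[OF ch])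
    show "chart_inv \<kappa> (?l t) \<in> fst \<kappa> \<inter> fst \<kappa>'" using that seg by (simp add: chart_inv_in[OF ch])
  qed
  have "continuous_on ?P (\<lambda>t. frechet_derivative ?\<tau> (at (?l t)) v)"
    by (rule continuous_on_frechet_derivative[OF \<tau> cont]) (use in_dom in auto)
  moreover have "(snd \<kappa>' \<circ> (\<lambda>t. chart_inv \<kappa> (?l t)) has_vector_derivative
      frechet_derivative ?\<tau> (at (?l t)) v) (at t within {0..1})" if t: "t \<in> ?P" for t
  proof -
    have l: "(?l has_derivative (\<lambda>h. h *\<^sub>R v)) (at t within {0..1})" by (auto intro!: derivative_eq_intros)
    have d: "(?\<tau> has_derivative frechet_derivative ?\<tau> (at (?l t))) (at (?l t))"
      by (rule C1_map_has_derivative[OF \<tau> in_dom[OF t]])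
    show ?thesis
      using has_derivative_compose[OF l d] linear_scale[OF has_derivative_linear[OF d]]
      by (simp add: has_vector_derivative_def o_def)
  qed
  ultimately show "\<exists>D. continuous_on ?P D \<and>
      (\<forall>t\<in>?P. (snd \<kappa>' \<circ> (\<lambda>t. chart_inv \<kappa> (?l t)) has_vector_derivative D t) (at t within {0..1}))"
    by blast
qed

text \<open>Yields both local smallness of the distance and, with connectedness, the existence of
  curves. Metric components are bounded on a compact coordinate ball, so the length of a coordinate
  segment is at most a constant times its Euclidean length.\<close>

lemma short_curves:
  assumes "e > 0"
  obtains U where "open U" "p \<in> U"
    "\<And>q. q \<in> U \<Longrightarrow> \<exists>\<gamma>. curve_between A p q \<gamma> \<and> curve_length A g \<gamma> < e"
proof -
  note atl = riemannian_manifold_atlas[OF Ag]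
  obtain \<kappa> where \<kappa>: "\<kappa> \<in> A" "p \<in> fst \<kappa>" using smooth_atlas_covers[OF atl] .
  note ch = smooth_atlas_chart[OF atl \<kappa>(1)]
  define x where "x = snd \<kappa> p"
  have "x \<in> snd \<kappa> ` fst \<kappa>" using \<kappa> by (simp add: x_def)
  then obtain r where r: "r > 0" "cball x r \<subseteq> snd \<kappa> ` fst \<kappa>"
    using open_chart_image[OF ch] open_contains_cball by blast
  \<comment> \<open>Since each coordinate of \<open>v\<close> is at most \<open>norm v\<close> in
    absolute value, \<open>G y\<close> times \<open>(norm v)\<^sup>2\<close> bounds the metric
    applied to \<open>v\<close> and \<open>v\<close> at the point with coordinate
    \<open>y\<close>.\<close>
  define G where "G y = (\<Sum>b\<in>Basis. \<Sum>c\<in>Basis. \<bar>g \<kappa> (chart_inv \<kappa> y) b c\<bar>)" for y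
  have "continuous_on (cball x r) G"
    unfolding G_def
    by (intro continuous_intros continuous_on_subset[OF metric_components_continuous_on[OF Ag \<kappa>(1)] r(2)])
  then have "bounded (G ` cball x r)"
    by (intro compact_imp_bounded compact_continuous_image) auto
  then obtain K where K: "K > 0" "\<And>y. y \<in> cball x r \<Longrightarrow> \<bar>G y\<bar> \<le> K"
    by (auto simp: bounded_pos)
  \<comment> \<open>The first bound keeps segments in the compact ball; the second makes the length
    estimate \<open>norm v * sqrt K\<close> smaller than \<open>e\<close>.\<close>
  define \<delta> where "\<delta> = min r (e / sqrt K)"
  have \<delta>: "\<delta> > 0" "\<delta> \<le> r" "\<delta> * sqrt K \<le> e"
    using r K \<open>e > 0\<close> by (auto simp: \<delta>_def min_def field_simps)
  define U where "U = chart_inv \<kappa> ` ball x \<delta>"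
  have sub: "ball x \<delta> \<subseteq> snd \<kappa> ` fst \<kappa>" using r \<delta> by force
  have "open U" unfolding U_def by (rule open_image_chart_inv[OF ch _ sub]) simp
  moreover have "p \<in> U"
    unfolding U_def by (rule image_eqI[of _ _ x]) (use \<delta> chart_inv_left[OF ch \<kappa>(2)] in \<open>simp_all add: x_def\<close>)
  moreover have "\<exists>\<gamma>. curve_between A p q \<gamma> \<and> curve_length A g \<gamma> < e" if q: "q \<in> U" for q
  proof -
    obtain y where y: "y \<in> ball x \<delta>" "q = chart_inv \<kappa> y" using q by (auto simp: U_def)
    define v where "v = y - x"
    have v: "norm v < \<delta>" using y by (simp add: v_def dist_norm norm_minus_commute)
    let ?\<gamma> = "\<lambda>t. chart_inv \<kappa> (x + t *\<^sub>R v)"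
    have seg: "x + t *\<^sub>R v \<in> cball x r" if "t \<in> {0..1}" for t
      using that v \<delta>(2) mult_left_le_one_le[of "norm v" t] by (simp add: dist_norm)
    have C1: "C1_curve_on A 0 1 ?\<gamma>"
      by (rule chart_segment_curve[OF \<kappa>(1)]) (use seg r in blast)
    have "curve_between A p q ?\<gamma>"
      using C1_curve_on_imp_piecewise[OF C1] y chart_inv_left[OF ch \<kappa>(2)]
      by (simp add: curve_between_def v_def x_def)
    moreover have "curve_length A g ?\<gamma> < e"
    proof -
      \<comment> \<open>\<open>speed_eq\<close> speaks of interior times only; the integral bound
        below tolerates the two exceptional endpoints.\<close>
      have sp: "norm (speed A g ?\<gamma> t) \<le> norm v * sqrt K" if t: "t \<in> cbox 0 1 - {0, 1}" for t
      proof -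
        have t': "t \<in> {0<..<1}" using t by auto
        have "((\<lambda>s. x + s *\<^sub>R v) has_vector_derivative v) (at t)"
          by (auto intro!: derivative_eq_intros simp: has_vector_derivative_def)
        then have vd: "(snd \<kappa> \<circ> ?\<gamma> has_vector_derivative v) (at t)"
        proof (rule has_vector_derivative_transform_within_open[of _ _ _ "{0<..<1}"])
          fix s :: real assume "s \<in> {0<..<1}"
          then have "x + s *\<^sub>R v \<in> snd \<kappa> ` fst \<kappa>" using seg[of s] r by auto
          then show "x + s *\<^sub>R v = (snd \<kappa> \<circ> ?\<gamma>) s" by (simp add: chart_inv_right[OF ch])
        qed (use t' in auto)
        have y: "x + t *\<^sub>R v \<in> cball x r" using t' by (intro seg) auto
        have \<gamma>t: "?\<gamma> t \<in> fst \<kappa>" by (rule chart_inv_in[OF ch]) (use y r in blast)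
        have "g \<kappa> (?\<gamma> t) v v = (\<Sum>b\<in>Basis. \<Sum>c\<in>Basis. (v \<bullet> b) * (v \<bullet> c) * g \<kappa> (?\<gamma> t) b c)"
          by (rule metric_expand[OF Ag \<kappa>(1) \<gamma>t])
        also have "\<dots> \<le> (\<Sum>b\<in>Basis. \<Sum>c\<in>Basis. norm v * norm v * \<bar>g \<kappa> (?\<gamma> t) b c\<bar>)"
        proof (intro sum_mono)
          fix b c :: 'e assume bc: "b \<in> Basis" "c \<in> Basis"
          have "(v \<bullet> b) * (v \<bullet> c) * g \<kappa> (?\<gamma> t) b c \<le> \<bar>v \<bullet> b\<bar> * \<bar>v \<bullet> c\<bar> * \<bar>g \<kappa> (?\<gamma> t) b c\<bar>"
            by (metis abs_ge_self abs_mult)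
          also have "\<dots> \<le> norm v * norm v * \<bar>g \<kappa> (?\<gamma> t) b c\<bar>"
            using bc by (intro mult_mono Basis_le_norm) auto
          finally show "(v \<bullet> b) * (v \<bullet> c) * g \<kappa> (?\<gamma> t) b c \<le> norm v * norm v * \<bar>g \<kappa> (?\<gamma> t) b c\<bar>" .
        qed
        also have "\<dots> = (norm v)\<^sup>2 * G (x + t *\<^sub>R v)"
          by (simp add: G_def sum_distrib_left power2_eq_square)
        also have "\<dots> \<le> (norm v)\<^sup>2 * K" using K(2)[OF y] by (intro mult_left_mono) auto
        finally have "sqrt (g \<kappa> (?\<gamma> t) v v) \<le> sqrt ((norm v)\<^sup>2 * K)" by (rule real_sqrt_le_mono)
        then show ?thesis
          using speed_eq[OF Ag C1 t' \<kappa>(1) \<gamma>t vd] speed_nonneg[OF Ag, of ?\<gamma> t] by (simp add: real_sqrt_mult)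
      qed
      have int: "(speed A g ?\<gamma> has_integral curve_length A g ?\<gamma>) (cbox 0 1)"
        using C1_curve_on_speed_integrable[OF Ag C1] by (simp add: curve_length_def integrable_integral)
      have "norm (curve_length A g ?\<gamma>) \<le> norm v * sqrt K * measure lborel (cbox 0 (1::real))"
        by (rule has_integral_bound_spike_finite[OF _ _ int sp, of "{0, 1}"]) (use K in simp_all)
      also have "\<dots> = norm v * sqrt K" by simp
      also have "\<dots> < \<delta> * sqrt K" using v K by simp
      finally show ?thesis using \<delta>(3) by simp
    qed
    ultimately show ?thesis by blast
  qed
  ultimately show thesis using that by blast
qed

lemma curve_length_nonneg: "0 \<le> curve_length A g \<gamma>"
proof (cases "speed A g \<gamma> integrable_on {0..1}")
  case True
  then show ?thesis
    unfolding curve_length_def by (rule Henstock_Kurzweil_Integration.integral_nonneg) (rule speed_nonneg[OF Ag])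
\<comment> \<open>If the speed is not integrable, \<open>integral\<close> has the default value
  0.\<close>
qed (simp add: curve_length_def not_integrable_integral)

lemma riemannian_dist_le_length:
  assumes "curve_between A x y \<gamma>"
  shows "riemannian_dist A g x y \<le> curve_length A g \<gamma>"
  unfolding riemannian_dist_eq
  using assms by (intro cInf_lower bdd_belowI[of _ 0]) (auto simp: curve_length_nonneg)

lemma riemannian_dist_le_integral:
  assumes "piecewise_C1_on A a b \<gamma>" "a < b"
  shows "riemannian_dist A g (\<gamma> a) (\<gamma> b) \<le> integral {a..b} (speed A g \<gamma>)"
  using curve_between_reparametrize[OF assms] riemannian_dist_le_length by metis

text \<open>The strict bounds on \<open>s\<close> keep both pieces nondegenerate, as rescaling to
  \<open>{0..1}\<close> requires.\<close>

lemma riemannian_dist_split: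
  assumes "curve_between A x y \<gamma>" "0 < s" "s < 1"
  shows "riemannian_dist A g x (\<gamma> s) + riemannian_dist A g (\<gamma> s) y \<le> curve_length A g \<gamma>"
proof -
  have \<gamma>: "piecewise_C1_on A 0 1 \<gamma>" "\<gamma> 0 = x" "\<gamma> 1 = y" using assms by (simp_all add: curve_between_def)
  have "riemannian_dist A g (\<gamma> 0) (\<gamma> s) \<le> integral {0..s} (speed A g \<gamma>)"
    "riemannian_dist A g (\<gamma> s) (\<gamma> 1) \<le> integral {s..1} (speed A g \<gamma>)"
    using assms by (auto intro!: riemannian_dist_le_integral piecewise_C1_on_subset[OF \<gamma>(1)])
  moreover have "integral {0..s} (speed A g \<gamma>) + integral {s..1} (speed A g \<gamma>) = curve_length A g \<gamma>"
    unfolding curve_length_def using assms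
    by (intro Henstock_Kurzweil_Integration.integral_combine piecewise_C1_on_speed_integrable[OF Ag \<gamma>(1)]) auto
  ultimately show ?thesis using \<gamma> by simp
qed

lemma riemannian_dist_small:
  assumes "e > 0"
  obtains U where "open U" "p \<in> U" "\<And>q. q \<in> U \<Longrightarrow> riemannian_dist A g p q < e"
  using short_curves[OF assms, of p] riemannian_dist_le_length by (metis order.strict_trans1)

lemma riemannian_dist_sym: "riemannian_dist A g x y = riemannian_dist A g y x"
proof -
  have "curve_length A g ` {\<gamma>. curve_between A x y \<gamma>} \<subseteq> curve_length A g ` {\<gamma>. curve_between A y x \<gamma>}" for x y
  proof clarify
    fix \<gamma> assume "curve_between A x y \<gamma>"
    then obtain \<delta> where "curve_between A y x \<delta>" "curve_length A g \<delta> = curve_length A g \<gamma>"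
      using curve_between_reverse by blast
    then show "curve_length A g \<gamma> \<in> curve_length A g ` {\<gamma>. curve_between A y x \<gamma>}"
      by (metis imageI mem_Collect_eq)
  qed
  then show ?thesis unfolding riemannian_dist_eq by (metis subset_antisym)
qed

context
  assumes conn: "connected (UNIV :: 'a set)"
begin

text \<open>Being joined by a curve is symmetric and transitive, and by \<open>short_curves\<close>
  it holds near every point; a connected space then has one class. Thus the infimum in the distance
  is over a nonempty set.\<close>

lemma curve_between_exists: "\<exists>\<gamma>. curve_between A x y \<gamma>"
proof (rule connected_equivalence_relation[OF conn, of x y "\<lambda>x y. \<exists>\<gamma>. curve_between A x y \<gamma>"])
  show "\<exists>\<gamma>. curve_between A y x \<gamma>" if "\<exists>\<gamma>. curve_between A x y \<gamma>" for x y
    using that curve_between_reverse by metis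
  show "\<exists>\<gamma>. curve_between A x z \<gamma>" if "\<exists>\<gamma>. curve_between A x y \<gamma>" "\<exists>\<gamma>. curve_between A y z \<gamma>" for x y z
    using that curve_between_join by metis
  fix p :: 'a
  show "\<exists>T. openin (top_of_set UNIV) T \<and> p \<in> T \<and> (\<forall>q\<in>T. \<exists>\<gamma>. curve_between A p q \<gamma>)"
    using short_curves[of 1 p] by (metis zero_less_one open_openin subtopology_UNIV)
qed auto

lemma riemannian_dist_approx:
  assumes "e > 0"
  obtains \<gamma> where "curve_between A x y \<gamma>" "curve_length A g \<gamma> < riemannian_dist A g x y + e"
proof -
  have "curve_length A g ` {\<gamma>. curve_between A x y \<gamma>} \<noteq> {}" using curve_between_exists by blast
  from cInf_lessD[OF this, of "riemannian_dist A g x y + e"] show thesis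
    using assms that by (auto simp: riemannian_dist_eq)
qed

lemma riemannian_dist_greatest:
  assumes "\<And>\<gamma>. curve_between A x y \<gamma> \<Longrightarrow> c \<le> curve_length A g \<gamma>"
  shows "c \<le> riemannian_dist A g x y"
  unfolding riemannian_dist_eq
  using curve_between_exists assms by (intro cInf_greatest) auto

lemma riemannian_dist_triangle:
  "riemannian_dist A g x z \<le> riemannian_dist A g x y + riemannian_dist A g y z"
proof (rule field_le_epsilon)
  fix e :: real assume "e > 0"
  then have e: "e / 2 > 0" by simp
  obtain \<gamma> where \<gamma>: "curve_between A x y \<gamma>" "curve_length A g \<gamma> < riemannian_dist A g x y + e / 2"
    using riemannian_dist_approx[OF e] .
  obtain \<delta> where \<delta>: "curve_between A y z \<delta>" "curve_length A g \<delta> < riemannian_dist A g y z + e / 2"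
    using riemannian_dist_approx[OF e] .
  obtain \<eta> where "curve_between A x z \<eta>" "curve_length A g \<eta> = curve_length A g \<gamma> + curve_length A g \<delta>"
    using curve_between_join[OF \<gamma>(1) \<delta>(1)] .
  then show "riemannian_dist A g x z \<le> riemannian_dist A g x y + riemannian_dist A g y z + e"
    using riemannian_dist_le_length \<gamma>(2) \<delta>(2) by fastforce
qed

end

end

section \<open>Comparing two manifolds\<close>

text \<open>The points \<open>z'\<close> and \<open>w'\<close> are not tied to a map, so the
  estimate can be applied with the two manifolds in either order.\<close>

lemma dist_le_dist_of_differences:
  fixes A :: "('a::t2_space, 'e::euclidean_space) chart set"
    and B :: "('b::t2_space, 'f::euclidean_space) chart set"
  assumes Ag: "riemannian_manifold A g" and Bh: "riemannian_manifold B h"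
    and conn: "connected (UNIV :: 'a set)" "connected (UNIV :: 'b set)"
    and D: "\<And>x. x \<in> M \<Longrightarrow> \<exists>y. riemannian_dist A g z x - riemannian_dist A g w x =
        riemannian_dist B h z' y - riemannian_dist B h w' y"
    and w: "w \<in> closure M"
  shows "riemannian_dist A g z w \<le> riemannian_dist B h z' w'"
proof (rule field_le_epsilon)
  fix e :: real assume "e > 0"
  \<comment> \<open>By the triangle inequality d(z, w) exceeds d(z, x) - d(w, x) by at most 2 d(w,
    x), hence the bound \<open>e / 2\<close> on d(w, x).\<close>
  then have "e / 2 > 0" by simp
  then obtain U where U: "open U" "w \<in> U" "\<And>q. q \<in> U \<Longrightarrow> riemannian_dist A g w q < e / 2"
    using riemannian_dist_small[OF Ag] by metis
  then obtain x where x: "x \<in> M" "x \<in> U"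
    using w by (metis closure_iff_nhds_not_empty disjoint_iff subset_refl)
  obtain y where y: "riemannian_dist A g z x - riemannian_dist A g w x =
      riemannian_dist B h z' y - riemannian_dist B h w' y"
    using D[OF x(1)] by blast
  show "riemannian_dist A g z w \<le> riemannian_dist B h z' w' + e"
    using riemannian_dist_triangle[OF Ag conn(1), of z w x] riemannian_dist_sym[OF Ag, of x w]
      U(3)[OF x(2)] y riemannian_dist_triangle[OF Bh conn(2), of z' y w'] by simp
qed

context
  fixes A :: "('a::t2_space, 'e::euclidean_space) chart set" and g :: "('a, 'e) metric_tensor"
    and B :: "('b::t2_space, 'f::euclidean_space) chart set" and h :: "('b, 'f) metric_tensor"
    and S :: "'a set" and \<phi> :: "'a \<Rightarrow> 'b"
  assumes Ag: "riemannian_manifold A g" and Bh: "riemannian_manifold B h"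
    and \<phi>: "smooth_map_on A B S \<phi>"
begin

text \<open>Off a finite set of times the velocity of the image curve is the differential applied to
  the velocity of \<gamma>, so the pullback identity equates the speeds.\<close>

lemma curve_length_image:
  assumes pull: "pullback_metric_eq A g B h S \<phi>"
    and \<gamma>: "piecewise_C1_on A 0 1 \<gamma>" "\<gamma> ` {0..1} \<subseteq> interior S"
  shows "curve_length B h (\<phi> \<circ> \<gamma>) = curve_length A g \<gamma>"
proof -
  note A = riemannian_manifold_atlas[OF Ag] and B = riemannian_manifold_atlas[OF Bh]
  obtain E where E: "finite E"
    "\<And>t. t \<in> {0..1} - E \<Longrightarrow> \<exists>u v. t \<in> {u<..<v} \<and> {u..v} \<subseteq> {0..1} \<and> C1_curve_on A u v \<gamma>"
    using piecewise_C1_on_derivative[OF \<gamma>(1)] by blast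
  have "speed A g \<gamma> t = speed B h (\<phi> \<circ> \<gamma>) t" if tE: "t \<in> {0..1} - E" for t
  proof -
    obtain u v where uv: "t \<in> {u<..<v}" "{u..v} \<subseteq> {0..1}" "C1_curve_on A u v \<gamma>" using E(2)[OF tE] by blast
    obtain \<kappa> where \<kappa>: "\<kappa> \<in> A" "\<gamma> t \<in> fst \<kappa>" using smooth_atlas_covers[OF A] .
    obtain \<kappa>' where \<kappa>': "\<kappa>' \<in> B" "\<phi> (\<gamma> t) \<in> fst \<kappa>'" using smooth_atlas_covers[OF B] .
    have at: "at t within {u..v} = at t" using uv(1) by (simp add: at_within_Icc_at)
    have c\<gamma>: "continuous_on {u..v} \<gamma>" using uv(3) by (simp add: C1_curve_on_def)
    have t: "t \<in> {u..v}" "u < v" using uv(1) by auto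
    have int: "\<gamma> ` {u..v} \<subseteq> interior S" using \<gamma>(2) uv(2) by blast
    then have \<gamma>t: "\<gamma> t \<in> interior S" using t by blast
    obtain D where D: "(snd \<kappa> \<circ> \<gamma> has_vector_derivative D) (at t within {u..v})"
      using uv(3) \<kappa> t unfolding C1_curve_on_def by blast
    have D': "(snd \<kappa>' \<circ> (\<phi> \<circ> \<gamma>) has_vector_derivative differential \<kappa> \<kappa>' S \<phi> (\<gamma> t) D) (at t within {u..v})"
      by (rule curve_coordinate_derivative[OF A B \<phi> open_interior interior_subset \<kappa>(1) \<kappa>'(1) c\<gamma> t(1) \<kappa>(2) \<gamma>t \<kappa>'(2) D])
    have C: "C1_curve_on B u v (\<phi> \<circ> \<gamma>)"
      by (rule C1_curve_on_image[OF A B \<phi> open_interior interior_subset uv(3) int t(2)])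
    have "h \<kappa>' (\<phi> (\<gamma> t)) (differential \<kappa> \<kappa>' S \<phi> (\<gamma> t) D) (differential \<kappa> \<kappa>' S \<phi> (\<gamma> t) D) = g \<kappa> (\<gamma> t) D D"
      using pull \<kappa> \<kappa>' \<gamma>t interior_subset unfolding pullback_metric_eq_def by blast
    then show ?thesis
      using speed_eq[OF Ag uv(3,1) \<kappa> D[unfolded at]] speed_eq[OF Bh C uv(1) \<kappa>'(1) _ D'[unfolded at]] \<kappa>'(2) by simp
  qed
  then show ?thesis unfolding curve_length_def using negligible_finite[OF E(1)] by (metis integral_spike)
qed

lemma curve_between_image:
  assumes "curve_between A x y \<gamma>" "\<gamma> ` {0..1} \<subseteq> interior S"
  shows "curve_between B (\<phi> x) (\<phi> y) (\<phi> \<circ> \<gamma>)"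
  using assms piecewise_C1_on_image[OF riemannian_manifold_atlas[OF Ag] riemannian_manifold_atlas[OF Bh] \<phi>
      open_interior interior_subset, of 0 1 \<gamma>]
  by (auto simp: curve_between_def)

text \<open>Puts \<phi> near \<open>p\<close> into the form to which the Euclidean invariance
  theorems apply: a continuous injection on a nonempty open set.\<close>

lemma coordinate_expression:
  assumes "p \<in> interior S" and inj: "inj_on \<phi> S"
  obtains \<kappa> \<kappa>' P where "\<kappa> \<in> A" "\<kappa>' \<in> B" "P \<subseteq> fst \<kappa> \<inter> S" "\<phi> ` P \<subseteq> fst \<kappa>'" "p \<in> P"
    "open (snd \<kappa> ` P)" "continuous_on (snd \<kappa> ` P) (snd \<kappa>' \<circ> \<phi> \<circ> chart_inv \<kappa>)"
    "inj_on (snd \<kappa>' \<circ> \<phi> \<circ> chart_inv \<kappa>) (snd \<kappa> ` P)"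
proof -
  note A = riemannian_manifold_atlas[OF Ag] and B = riemannian_manifold_atlas[OF Bh]
  obtain \<kappa> where \<kappa>: "\<kappa> \<in> A" "p \<in> fst \<kappa>" using smooth_atlas_covers[OF A] .
  obtain \<kappa>' where \<kappa>': "\<kappa>' \<in> B" "\<phi> p \<in> fst \<kappa>'" using smooth_atlas_covers[OF B] .
  note ch = smooth_atlas_chart[OF A \<kappa>(1)] and ch' = smooth_atlas_chart[OF B \<kappa>'(1)]
  define P where "P = fst \<kappa> \<inter> interior S \<inter> \<phi> -` fst \<kappa>'"
  have P: "P \<subseteq> fst \<kappa> \<inter> S" "\<phi> ` P \<subseteq> fst \<kappa>'" using interior_subset by (auto simp: P_def)
  have "inj_on (snd \<kappa>' \<circ> \<phi> \<circ> chart_inv \<kappa>) (snd \<kappa> ` P)"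
  proof (rule inj_onI, clarsimp)
    fix q q' assume q: "q \<in> P" "q' \<in> P"
      "snd \<kappa>' (\<phi> (chart_inv \<kappa> (snd \<kappa> q))) = snd \<kappa>' (\<phi> (chart_inv \<kappa> (snd \<kappa> q')))"
    have "q \<in> fst \<kappa>" "q' \<in> fst \<kappa>" "q \<in> S" "q' \<in> S" "\<phi> q \<in> fst \<kappa>'" "\<phi> q' \<in> fst \<kappa>'" using q P by auto
    then have "\<phi> q = \<phi> q'" using q(3) chart_inv_left[OF ch] chart_inv_left[OF ch'] by metis
    then show "snd \<kappa> q = snd \<kappa> q'" using inj \<open>q \<in> S\<close> \<open>q' \<in> S\<close> by (metis inj_onD)
  qed
  moreover have "open (snd \<kappa> ` P)"
    by (rule open_image_chart[OF ch])
      (use open_coordinate_domain[OF A B \<phi> open_interior interior_subset \<kappa>(1) \<kappa>'(1)] P in \<open>auto simp: P_def\<close>)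
  moreover have "continuous_on (snd \<kappa> ` P) (snd \<kappa>' \<circ> \<phi> \<circ> chart_inv \<kappa>)"
    unfolding P_def
    by (rule C1_map_continuous_on[OF C1_map_coordinates[OF A B \<phi> open_interior interior_subset \<kappa>(1) \<kappa>'(1)]])
  moreover have "p \<in> P" using assms \<kappa> \<kappa>' by (simp add: P_def)
  ultimately show thesis using that \<kappa>(1) \<kappa>'(1) P by blast
qed

text \<open>Applied to a diffeomorphism and its inverse, this equates the dimensions of the two
  model spaces, the prerequisite for invariance of domain.\<close>

lemma smooth_injection_dimension_le:
  assumes "inj_on \<phi> S" "interior S \<noteq> {}"
  shows "DIM('e) \<le> DIM('f)"
proof -
  obtain p where "p \<in> interior S" using assms by blast
  from coordinate_expression[OF this assms(1)] show ?thesis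
    using invariance_of_dimension by (metis empty_iff imageI)
qed

text \<open>Invariance of domain makes the coordinate image of a neighbourhood of \<open>p\<close>
  open, and the target chart carries this back to the manifold.\<close>

lemma smooth_injection_interior:
  assumes inj: "inj_on \<phi> S" and dim: "DIM('f) \<le> DIM('e)" and p: "p \<in> interior S"
  shows "\<phi> p \<in> interior (\<phi> ` S)"
proof -
  note A = riemannian_manifold_atlas[OF Ag] and B = riemannian_manifold_atlas[OF Bh]
  obtain \<kappa> \<kappa>' P where P: "\<kappa> \<in> A" "\<kappa>' \<in> B" "P \<subseteq> fst \<kappa> \<inter> S" "\<phi> ` P \<subseteq> fst \<kappa>'" "p \<in> P"
    "open (snd \<kappa> ` P)" "continuous_on (snd \<kappa> ` P) (snd \<kappa>' \<circ> \<phi> \<circ> chart_inv \<kappa>)"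
    "inj_on (snd \<kappa>' \<circ> \<phi> \<circ> chart_inv \<kappa>) (snd \<kappa> ` P)"
    using coordinate_expression[OF p inj] .
  note ch = smooth_atlas_chart[OF A P(1)] and ch' = smooth_atlas_chart[OF B P(2)]
  have "(snd \<kappa>' \<circ> \<phi> \<circ> chart_inv \<kappa>) ` snd \<kappa> ` P = snd \<kappa>' ` \<phi> ` P"
    unfolding image_comp by (rule image_cong) (use P(3) chart_inv_left[OF ch] in auto)
  then have "open (snd \<kappa>' ` \<phi> ` P)"
    using invariance_of_domain_gen[OF P(6,7,8) dim] by simp
  then have "open (chart_inv \<kappa>' ` snd \<kappa>' ` \<phi> ` P)"
    by (rule open_image_chart_inv[OF ch']) (use P(4) in blast)
  moreover have "chart_inv \<kappa>' ` snd \<kappa>' ` \<phi> ` P = \<phi> ` P"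
    using P(4) chart_inv_left[OF ch'] by (force simp: image_iff)
  ultimately have "open (\<phi> ` P)" by simp
  then show ?thesis using P(3,5) by (intro interiorI[of "\<phi> ` P"]) auto
qed

text \<open>Length preservation and the frontier case enter as hypotheses so that the lemma serves
  \<phi> and also its inverse, which comes with no pullback identity of its own.\<close>

lemma dist_image_le:
  assumes conn: "connected (UNIV :: 'a set)" "connected (UNIV :: 'b set)"
    and "closed S"
    and interior: "\<And>x y \<gamma>. curve_between A x y \<gamma> \<Longrightarrow> \<gamma> ` {0..1} \<subseteq> interior S \<Longrightarrow>
        curve_length B h (\<phi> \<circ> \<gamma>) = curve_length A g \<gamma>"
    and frontier: "\<And>z w. z \<in> S \<Longrightarrow> w \<in> frontier S \<Longrightarrow>
        riemannian_dist B h (\<phi> z) (\<phi> w) \<le> riemannian_dist A g z w"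
    and zw: "z \<in> S" "w \<in> S"
  shows "riemannian_dist B h (\<phi> z) (\<phi> w) \<le> riemannian_dist A g z w"
proof (rule riemannian_dist_greatest[OF Ag conn(1)])
  fix \<gamma> assume \<gamma>: "curve_between A z w \<gamma>"
  have frontier': "riemannian_dist B h (\<phi> w') (\<phi> z') \<le> riemannian_dist A g w' z'"
    if "z' \<in> S" "w' \<in> frontier S" for z' w'
    using frontier[OF that] riemannian_dist_sym[OF Ag] riemannian_dist_sym[OF Bh] by metis
  have ends: "\<gamma> 0 = z" "\<gamma> 1 = w" and cont: "continuous_on {0..1} \<gamma>"
    using \<gamma> by (simp_all add: curve_between_def piecewise_C1_on_def)
  show "riemannian_dist B h (\<phi> z) (\<phi> w) \<le> curve_length A g \<gamma>"
  proof (cases "\<gamma> ` {0..1} \<inter> frontier S = {}")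
    case True
    have "connected (\<gamma> ` {0..1})" using cont by (intro connected_continuous_image) auto
    moreover have "\<gamma> 0 \<in> \<gamma> ` {0..1} \<inter> S" using ends zw by auto
    \<comment> \<open>A connected set that meets \<open>S\<close> and misses its frontier cannot
      leave \<open>S\<close>.\<close>
    ultimately have "\<gamma> ` {0..1} \<subseteq> S" using True connected_Int_frontier by blast
    then have "\<gamma> ` {0..1} \<subseteq> interior S"
      using True closure_subset[of S] unfolding frontier_def by blast
    with riemannian_dist_le_length[OF Bh curve_between_image[OF \<gamma>]] interior[OF \<gamma>] show ?thesis by simp
  next
    case False
    then obtain s where s: "s \<in> {0..1}" "\<gamma> s \<in> frontier S" by blast
    show ?thesis
    proof (cases "s \<in> {0<..<1}")
      case True
      \<comment> \<open>The curve may leave \<open>S\<close> elsewhere and need not be mapped: only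
        its point \<open>\<gamma> s\<close> is, and both halves are instances of the frontier
        case.\<close>
      have "riemannian_dist B h (\<phi> z) (\<phi> w) \<le>
          riemannian_dist B h (\<phi> z) (\<phi> (\<gamma> s)) + riemannian_dist B h (\<phi> (\<gamma> s)) (\<phi> w)"
        by (rule riemannian_dist_triangle[OF Bh conn(2)])
      also have "\<dots> \<le> riemannian_dist A g z (\<gamma> s) + riemannian_dist A g (\<gamma> s) w"
        by (intro add_mono frontier frontier' zw s)
      also have "\<dots> \<le> curve_length A g \<gamma>" using True by (intro riemannian_dist_split[OF Ag \<gamma>]) auto
      finally show ?thesis .
    next
      case False
      then have "s = 0 \<or> s = 1" using s by auto
      then have "z \<in> frontier S \<or> w \<in> frontier S" using s(2) ends by auto
      then have "riemannian_dist B h (\<phi> z) (\<phi> w) \<le> riemannian_dist A g z w"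
        using frontier frontier' zw by blast
      then show ?thesis using riemannian_dist_le_length[OF Ag \<gamma>] by simp
    qed
  qed
qed

end

section \<open>Distances from distance differences\<close>

text \<open>Evaluation at a pair in the domain removes both restrictions; the inclusion of the image
  in \<open>G\<close> keeps the inner one from returning \<open>undefined\<close>.\<close>

lemma dist_diff_pullback_eqD:
  assumes "dist_diff A g F x = (\<lambda>(z, w)\<in>F \<times> F. dist_diff B h G y (\<phi> z, \<phi> w))" "\<phi> ` F \<subseteq> G"
    "z \<in> F" "w \<in> F"
  shows "riemannian_dist A g z x - riemannian_dist A g w x =
    riemannian_dist B h (\<phi> z) y - riemannian_dist B h (\<phi> w) y"
  using fun_cong[OF assms(1), of "(z, w)"] assms(2-4) by (auto simp: dist_diff_def)

theorem proposition1p2: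
  fixes A1 :: "('a::{t2_space,second_countable_topology}, 'e::euclidean_space) chart set"
    and A2 :: "('b::{t2_space,second_countable_topology}, 'f::euclidean_space) chart set"
    and g1 :: "('a, 'e) metric_tensor" and g2 :: "('b, 'f) metric_tensor"
    and M1 F1 :: "'a set" and M2 F2 :: "'b set"
    and \<phi> :: "'a \<Rightarrow> 'b"
  assumes "riemannian_manifold A1 g1" and "riemannian_manifold A2 g2"
    and "compact (UNIV :: 'a set)" and "compact (UNIV :: 'b set)"
    and "connected (UNIV :: 'a set)" and "connected (UNIV :: 'b set)"
    and "open M1" and "open M2"
    and "F1 = UNIV - M1" and "F2 = UNIV - M2"
    and "interior F1 \<noteq> {}" and "interior F2 \<noteq> {}"
    and "smooth_submanifold_with_boundary A1 F1" and "smooth_submanifold_with_boundary A2 F2"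
    and "manifold_boundary A1 F1 = frontier M1" and "manifold_boundary A2 F2 = frontier M2"
    and "diffeomorphism_on A1 A2 F1 F2 \<phi>"
    and "pullback_metric_eq A1 g1 A2 g2 F1 \<phi>"
    and "{dist_diff A1 g1 F1 x |x. x \<in> M1} =
         {(\<lambda>(z, w)\<in>F1 \<times> F1. dist_diff A2 g2 F2 y (\<phi> z, \<phi> w)) |y. y \<in> M2}"
  shows "(\<forall>z\<in>F1. \<forall>w\<in>F1. riemannian_dist A1 g1 z w = riemannian_dist A2 g2 (\<phi> z) (\<phi> w)) \<and>
         {dist_diff A1 g1 F1 x |x. x \<in> UNIV} =
         {(\<lambda>(z, w)\<in>F1 \<times> F1. dist_diff A2 g2 F2 y (\<phi> z, \<phi> w)) |y. y \<in> UNIV}"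
proof -
  define \<psi> where "\<psi> = inv_into F1 \<phi>"
  note R1 = assms(1) and R2 = assms(2) and conn1 = assms(5) and conn2 = assms(6)
    and F1 = assms(9) and F2 = assms(10)
  let ?D1 = "dist_diff A1 g1 F1" and ?D2 = "\<lambda>y. \<lambda>(z, w)\<in>F1 \<times> F1. dist_diff A2 g2 F2 y (\<phi> z, \<phi> w)"
  have D_eq: "?D1 ` M1 = ?D2 ` M2" using assms(19) by (simp only: Setcompr_eq_image)
  have bij: "bij_betw \<phi> F1 F2" and s\<phi>: "smooth_map_on A1 A2 F1 \<phi>" and s\<psi>: "smooth_map_on A2 A1 F2 \<psi>"
    using assms(17) by (simp_all add: diffeomorphism_on_def \<psi>_def)
  have bij': "bij_betw \<psi> F2 F1" unfolding \<psi>_def by (rule bij_betw_inv_into[OF bij])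
  have img: "\<phi> ` F1 = F2" "\<psi> ` F2 = F1" and inj: "inj_on \<phi> F1" "inj_on \<psi> F2"
    using bij bij' by (simp_all add: bij_betw_def)
  have \<psi>\<phi>: "\<psi> (\<phi> z) = z" if "z \<in> F1" for z
    unfolding \<psi>_def by (rule bij_betw_inv_into_left[OF bij that])
  have \<phi>\<psi>: "\<phi> (\<psi> z) = z" if "z \<in> F2" for z
    unfolding \<psi>_def by (rule bij_betw_inv_into_right[OF bij that])
  have \<phi>F: "\<phi> z \<in> F2" if "z \<in> F1" for z using img that by blast
  have \<psi>F: "\<psi> z \<in> F1" if "z \<in> F2" for z using img that by blast

  \<comment> \<open>Dimensions, interiors and boundaries correspond under \<phi>\<close>
  have dim: "DIM('e) \<le> DIM('f)" "DIM('f) \<le> DIM('e)"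
    using smooth_injection_dimension_le[OF R1 R2 s\<phi> inj(1)] smooth_injection_dimension_le[OF R2 R1 s\<psi> inj(2)]
      assms(11,12) by blast+
  have int\<phi>: "\<phi> p \<in> interior F2" if "p \<in> interior F1" for p
    using smooth_injection_interior[OF R1 R2 s\<phi> inj(1) dim(2) that] img by simp
  have int\<psi>: "\<psi> q \<in> interior F1" if "q \<in> interior F2" for q
    using smooth_injection_interior[OF R2 R1 s\<psi> inj(2) dim(1) that] img by simp
  have closed: "closed F1" "closed F2" using assms(7,8) F1 F2 by (simp_all add: closed_Compl flip: Compl_eq_Diff_UNIV)
  have fr1: "frontier F1 \<subseteq> F1" "frontier F1 \<subseteq> closure M1" and fr2: "frontier F2 \<subseteq> F2" "frontier F2 \<subseteq> closure M2"
    using frontier_complement[of M1] frontier_complement[of M2] F1 F2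
    by (auto simp: Compl_eq_Diff_UNIV frontier_def[of M1] frontier_def[of M2] interior_open assms(7,8))
  \<comment> \<open>If \<phi> moved a frontier point into the interior, \<psi> would bring it back
    as an interior point of \<open>F1\<close>.\<close>
  have \<phi>fr: "\<phi> w \<in> frontier F2" if "w \<in> frontier F1" for w
  proof -
    have "w \<in> F1" "w \<notin> interior F1" using that fr1 by (auto simp: frontier_def)
    then show ?thesis
      using int\<psi>[of "\<phi> w"] \<psi>\<phi> \<phi>F closure_subset unfolding frontier_def by fastforce
  qed
  have \<psi>fr: "\<psi> w \<in> frontier F1" if "w \<in> frontier F2" for w
  proof -
    have "w \<in> F2" "w \<notin> interior F2" using that fr2 by (auto simp: frontier_def)
    then show ?thesis
      using int\<phi>[of "\<psi> w"] \<phi>\<psi> \<psi>F closure_subset unfolding frontier_def by fastforce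
  qed

  \<comment> \<open>The inequalities with one point on the boundary\<close>
  have le12: "riemannian_dist A1 g1 z w \<le> riemannian_dist A2 g2 (\<phi> z) (\<phi> w)"
    if zw: "z \<in> F1" "w \<in> frontier F1" for z w
  proof (rule dist_le_dist_of_differences[OF R1 R2 conn1 conn2, of M1])
    have w: "w \<in> F1" "w \<in> closure M1" using zw fr1 by auto
    then show "w \<in> closure M1" by blast
    fix x assume "x \<in> M1"
    then have "?D1 x \<in> ?D2 ` M2" unfolding D_eq[symmetric] by (rule imageI)
    then obtain y where "?D1 x = ?D2 y" by (rule imageE) (rule that)
    from dist_diff_pullback_eqD[OF this _ zw(1) w(1)] img
    show "\<exists>y. riemannian_dist A1 g1 z x - riemannian_dist A1 g1 w x =
        riemannian_dist A2 g2 (\<phi> z) y - riemannian_dist A2 g2 (\<phi> w) y" by blast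
  qed
  have le21: "riemannian_dist A2 g2 z w \<le> riemannian_dist A1 g1 (\<psi> z) (\<psi> w)"
    if zw: "z \<in> F2" "w \<in> frontier F2" for z w
  proof (rule dist_le_dist_of_differences[OF R2 R1 conn2 conn1, of M2])
    have w: "w \<in> F2" "w \<in> closure M2" using zw fr2 by auto
    then show "w \<in> closure M2" by blast
    fix y assume "y \<in> M2"
    then have "?D2 y \<in> ?D1 ` M1" unfolding D_eq by (rule imageI)
    then obtain x where "?D2 y = ?D1 x" by (rule imageE) (rule that)
    from dist_diff_pullback_eqD[OF this[symmetric] _ \<psi>F[OF zw(1)] \<psi>F[OF w(1)]] img
    show "\<exists>x. riemannian_dist A2 g2 z y - riemannian_dist A2 g2 w y =
        riemannian_dist A1 g1 (\<psi> z) x - riemannian_dist A1 g1 (\<psi> w) x"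
      using \<phi>\<psi>[OF zw(1)] \<phi>\<psi>[OF w(1)] by (intro exI[of _ x]) simp
  qed

  \<comment> \<open>The inequalities for arbitrary points, in both directions\<close>
  have up: "riemannian_dist A2 g2 (\<phi> z) (\<phi> w) \<le> riemannian_dist A1 g1 z w" if "z \<in> F1" "w \<in> F1" for z w
  proof (rule dist_image_le[OF R1 R2 s\<phi> conn1 conn2 closed(1) _ _ that])
    show "curve_length A2 g2 (\<phi> \<circ> \<gamma>) = curve_length A1 g1 \<gamma>"
      if "curve_between A1 x y \<gamma>" "\<gamma> ` {0..1} \<subseteq> interior F1" for x y \<gamma>
      using that by (intro curve_length_image[OF R1 R2 s\<phi> assms(18)]) (simp_all add: curve_between_def)
    show "riemannian_dist A2 g2 (\<phi> z) (\<phi> w) \<le> riemannian_dist A1 g1 z w"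
      if "z \<in> F1" "w \<in> frontier F1" for z w
      using le21[OF \<phi>F \<phi>fr, OF that] \<psi>\<phi>[OF that(1)] \<psi>\<phi>[of w] that(2) fr1 by auto
  qed
  have down: "riemannian_dist A1 g1 (\<psi> z) (\<psi> w) \<le> riemannian_dist A2 g2 z w" if "z \<in> F2" "w \<in> F2" for z w
  proof (rule dist_image_le[OF R2 R1 s\<psi> conn2 conn1 closed(2) _ _ that])
    fix x y \<gamma> assume \<gamma>: "curve_between A2 x y \<gamma>" "\<gamma> ` {0..1} \<subseteq> interior F2"
    \<comment> \<open>The metric hypothesis concerns \<phi>. Applying it to the curve
      \<open>\<psi> \<circ> \<gamma>\<close>, which \<phi> carries back to \<gamma>, shows that
      \<psi> preserves length as well.\<close>
    have "curve_length A2 g2 (\<phi> \<circ> (\<psi> \<circ> \<gamma>)) = curve_length A1 g1 (\<psi> \<circ> \<gamma>)"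
    proof (rule curve_length_image[OF R1 R2 s\<phi> assms(18)])
      show "piecewise_C1_on A1 0 1 (\<psi> \<circ> \<gamma>)"
        using curve_between_image[OF R2 R1 s\<psi> \<gamma>] by (simp add: curve_between_def)
      show "(\<psi> \<circ> \<gamma>) ` {0..1} \<subseteq> interior F1" using \<gamma>(2) int\<psi> by auto
    qed
    moreover have "(\<phi> \<circ> (\<psi> \<circ> \<gamma>)) t = \<gamma> t" if "t \<in> {0..1}" for t
    proof -
      have "\<gamma> t \<in> F2" using \<gamma>(2) interior_subset that by blast
      then show ?thesis by (simp add: \<phi>\<psi>)
    qed
    then have "curve_length A2 g2 (\<phi> \<circ> (\<psi> \<circ> \<gamma>)) = curve_length A2 g2 \<gamma>"
      unfolding curve_length_def by (rule integral_speed_cong)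
    ultimately show "curve_length A1 g1 (\<psi> \<circ> \<gamma>) = curve_length A2 g2 \<gamma>" by simp
  next
    show "riemannian_dist A1 g1 (\<psi> z) (\<psi> w) \<le> riemannian_dist A2 g2 z w"
      if "z \<in> F2" "w \<in> frontier F2" for z w
      using le12[OF \<psi>F \<psi>fr, OF that] \<phi>\<psi>[OF that(1)] \<phi>\<psi>[of w] that(2) fr2 by auto
  qed

  \<comment> \<open>The isometry and the equality of the full families of difference
    functions\<close>
  have iso: "riemannian_dist A1 g1 z w = riemannian_dist A2 g2 (\<phi> z) (\<phi> w)" if "z \<in> F1" "w \<in> F1" for z w
    using up[OF that] down[OF \<phi>F \<phi>F, OF that] \<psi>\<phi> that by fastforce
  \<comment> \<open>For a base point in \<open>F1\<close> the isometry matches the functions one by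
    one; the base points in \<open>M1\<close> and \<open>M2\<close> are covered by
    \<open>D_eq\<close>, as an equality of images.\<close>
  have "?D1 x = ?D2 (\<phi> x)" if "x \<in> F1" for x
    unfolding dist_diff_def by (rule restrict_ext) (use that \<phi>F iso in auto)
  then have "?D1 ` F1 = ?D2 ` \<phi> ` F1" by (simp add: image_image)
  then have "?D1 ` (M1 \<union> F1) = ?D2 ` (M2 \<union> F2)" by (simp only: image_Un img D_eq)
  moreover have "M1 \<union> F1 = UNIV" "M2 \<union> F2 = UNIV" using F1 F2 by auto
  ultimately have "?D1 ` UNIV = ?D2 ` UNIV" by simp
  then show ?thesis using iso by (simp only: Setcompr_eq_image) blast
qed

end
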